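(* Let $\alpha$ be an FLIF expression and let $\rho$ be a bijection from $O(\alpha)$ onto a set of variables disjoint from $\mathrm{vars}(\alpha)$. Then there exists an io-disjoint FLIF expression $\beta$ such that (1) $I(\beta)=I(\alpha)$; (2) $O(\beta)\supseteq\rho(O(\alpha))$; and (3) for every instance $D$ and every $\mathbb V$-valuation $\nu_1$, \[\{\nu_2|_{O(\alpha)}\mid(\nu_1,\nu_2)\in[\![\alpha]\!]^{\mathbb V}_D\}=\{\nu_2\circ\rho\mid(\nu_1,\nu_2)\in[\![\beta]\!]^{\mathbb V}_D\},\] where $\mathbb V$ is any set of variables containing $\mathrm{vars}(\alpha)$ and $\mathrm{vars}(\beta)$.
   Context: Fix a countably infinite set $\mathbf{dom}$ of constants. A schema $\mathcal S$ is a finite set of relation names $R$ with arity $\mathrm{ar}(R)$ and input arity $\mathrm{iar}(R)\le\mathrm{ar}(R)$; $\mathrm{oar}(R)=\mathrm{ar}(R)-\mathrm{iar}(R)$. An instance $D$ assigns each $R$ a relation $D(R)\subseteq\mathbf{dom}^{\mathrm{ar}(R)}$. An $X$-valuation is a map $X\to\mathbf{dom}$; $\nu(c)=c$ for constants; $\nu[x:=c]$ is $\nu$ changed at $x$. FLIF expressions over $\mathcal S$ and $\mathbb V$: atomic $R(\bar x;\bar y)$ ($\bar x$ of length $\mathrm{iar}(R)$, $\bar y$ of length $\mathrm{oar}(R)$, variables in $\mathbb V$), $(x=y)$, $(x=c)$, $(x:=y)$, $(x:=c)$; closed under $;$, $\cup$, $-$. $\mathrm{vars}(\alpha)$ is the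 set of variables occurring in $\alpha$. Semantics $[\![\alpha]\!]^{\mathbb V}_D$ (pairs of $\mathbb V$-valuations): $R(\bar x;\bar y)$: $(\nu_1,\nu_2)$ with $\nu_1(\bar x)\cdot\nu_2(\bar y)\in D(R)$ and $\nu_1,\nu_2$ agreeing outside the variables of $\bar y$; $(x=y)$: $(\nu,\nu)$ with $\nu(x)=\nu(y)$; $(x=c)$: $(\nu,\nu)$ with $\nu(x)=c$; $(x:=y)$: $(\nu,\nu[x:=\nu(y)])$; $(x:=c)$: $(\nu,\nu[x:=c])$; $;$ is relational composition, $\cup,-$ are union and difference. Input/output variables: $I(R(\bar x;\bar y))=X$, $O=Y$ (variables of $\bar x$, $\bar y$); $I(x=y)=\{x,y\}$, $O=\emptyset$; $I(x:=y)=\{y\}$, $O=\{x\}$; $I(x=c)=\{x\}$, $O=\emptyset$; $I(x:=c)=\emptyset$, $O=\{x\}$; $I(\alpha_1;\alpha_2)=I(\alpha_1)\cup(I(\alpha_2)\setminus O(\alpha_1))$, $O=O(\alpha_1)\cup O(\alpha_2)$; $I(\alpha_1\cup\alpha_2)=I(\alpha_1)\cup I(\alpha_2)\cup(O(\alpha_1)\triangle O(\alpha_2))$, $O=O(\alpha_1)\cup O(\alpha_2)$; $I(\alpha_1-\alpha_2)=I(\alpha_1)\cup I(\alpha_2)\cup(O(\alpha_1)\triangle O(\alpha_2))$, $O=O(\alpha_1)$. An expression is io-disjoint if $I(\beta)\cap O(\beta)=\emptyset$ for every subexpression $\beta$ (including itself). $\nu_2\circ\rho$ denotes the map $O(\alpha)\to\mathbf{dom}$,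 $x\mapsto\nu_2(\rho(x))$. *)

theory Defs
  imports Main "HOL-Library.FuncSet" "HOL-Library.Countable_Set"
begin

record 'r schema =
  rels :: "'r set"
  ar :: "'r \<Rightarrow> nat"
  iar :: "'r \<Rightarrow> nat"

definition oar :: "'r schema \<Rightarrow> 'r \<Rightarrow> nat" where
  "oar S R = ar S R - iar S R"

definition is_schema :: "'r schema \<Rightarrow> bool" where
  "is_schema S \<longleftrightarrow> finite (rels S) \<and> (\<forall>R\<in>rels S. iar S R \<le> ar S R)"

text \<open>The set of constants is the whole type \<open>'d\<close>. Values of \<open>D\<close> outside
  \<open>rels S\<close> are never consulted by expressions over \<open>S\<close>.\<close>

definition is_instance :: "'r schema \<Rightarrow> ('r \<Rightarrow> 'd list set) \<Rightarrow> bool" where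
  "is_instance S D \<longleftrightarrow> (\<forall>R\<in>rels S. D R \<subseteq> {t. length t = ar S R})"

text \<open>\<open>vars\<close> is the set function generated for the second type parameter, that is,
  the set of all variables occurring in an expression.\<close>

datatype ('r, vars: 'v, 'd) flif =
    Rel 'r "'v list" "'v list"
  | EqVar 'v 'v
  | EqConst 'v 'd
  | AsgVar 'v 'v
  | AsgConst 'v 'd
  | Seq "('r, 'v, 'd) flif" "('r, 'v, 'd) flif"
  | Cup "('r, 'v, 'd) flif" "('r, 'v, 'd) flif"
  | Minus "('r, 'v, 'd) flif" "('r, 'v, 'd) flif"

text \<open>\<open>\<alpha>\<close> is an FLIF expression over \<open>S\<close> and a variable set \<open>V\<close> iff
  \<open>is_flif S \<alpha>\<close> and \<open>vars \<alpha> \<subseteq> V\<close>.\<close>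

primrec is_flif :: "'r schema \<Rightarrow> ('r, 'v, 'd) flif \<Rightarrow> bool" where
  "is_flif S (Rel R xs ys) \<longleftrightarrow> R \<in> rels S \<and> length xs = iar S R \<and> length ys = oar S R"
| "is_flif S (EqVar x y) \<longleftrightarrow> True"
| "is_flif S (EqConst x c) \<longleftrightarrow> True"
| "is_flif S (AsgVar x y) \<longleftrightarrow> True"
| "is_flif S (AsgConst x c) \<longleftrightarrow> True"
| "is_flif S (Seq \<alpha> \<beta>) \<longleftrightarrow> is_flif S \<alpha> \<and> is_flif S \<beta>"
| "is_flif S (Cup \<alpha> \<beta>) \<longleftrightarrow> is_flif S \<alpha> \<and> is_flif S \<beta>"
| "is_flif S (Minus \<alpha> \<beta>) \<longleftrightarrow> is_flif S \<alpha> \<and> is_flif S \<beta>"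

text \<open>Maps from a set \<open>X\<close> to constants are represented as total functions that are
  \<open>undefined\<close> outside \<open>X\<close>, so that equality of functions is equality of maps on \<open>X\<close>.\<close>

definition valuations :: "'v set \<Rightarrow> ('v \<Rightarrow> 'd) set" where
  "valuations X = (X \<rightarrow>\<^sub>E UNIV)"

text \<open>Only meaningful when \<open>vars \<alpha> \<subseteq> V\<close>; in particular an assignment then
  keeps a \<open>V\<close>-valuation a \<open>V\<close>-valuation.\<close>

primrec sem :: "'v set \<Rightarrow> ('r \<Rightarrow> 'd list set) \<Rightarrow> ('r, 'v, 'd) flif \<Rightarrow>
    (('v \<Rightarrow> 'd) \<times> ('v \<Rightarrow> 'd)) set" where
  "sem V D (Rel R xs ys) = {(\<nu>1, \<nu>2). \<nu>1 \<in> valuations V \<and> \<nu>2 \<in> valuations V \<and>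
     map \<nu>1 xs @ map \<nu>2 ys \<in> D R \<and> (\<forall>v\<in>V - set ys. \<nu>1 v = \<nu>2 v)}"
| "sem V D (EqVar x y) = {(\<nu>, \<nu>) | \<nu>. \<nu> \<in> valuations V \<and> \<nu> x = \<nu> y}"
| "sem V D (EqConst x c) = {(\<nu>, \<nu>) | \<nu>. \<nu> \<in> valuations V \<and> \<nu> x = c}"
| "sem V D (AsgVar x y) = {(\<nu>, \<nu>(x := \<nu> y)) | \<nu>. \<nu> \<in> valuations V}"
| "sem V D (AsgConst x c) = {(\<nu>, \<nu>(x := c)) | \<nu>. \<nu> \<in> valuations V}"
| "sem V D (Seq \<alpha> \<beta>) = sem V D \<alpha> O sem V D \<beta>"
| "sem V D (Cup \<alpha> \<beta>) = sem V D \<alpha> \<union> sem V D \<beta>"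
| "sem V D (Minus \<alpha> \<beta>) = sem V D \<alpha> - sem V D \<beta>"

primrec outs :: "('r, 'v, 'd) flif \<Rightarrow> 'v set" where
  "outs (Rel R xs ys) = set ys"
| "outs (EqVar x y) = {}"
| "outs (EqConst x c) = {}"
| "outs (AsgVar x y) = {x}"
| "outs (AsgConst x c) = {x}"
| "outs (Seq \<alpha> \<beta>) = outs \<alpha> \<union> outs \<beta>"
| "outs (Cup \<alpha> \<beta>) = outs \<alpha> \<union> outs \<beta>"
| "outs (Minus \<alpha> \<beta>) = outs \<alpha>"

primrec ins :: "('r, 'v, 'd) flif \<Rightarrow> 'v set" where
  "ins (Rel R xs ys) = set xs"
| "ins (EqVar x y) = {x, y}"
| "ins (EqConst x c) = {x}"
| "ins (AsgVar x y) = {y}"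
| "ins (AsgConst x c) = {}"
| "ins (Seq \<alpha> \<beta>) = ins \<alpha> \<union> (ins \<beta> - outs \<alpha>)"
| "ins (Cup \<alpha> \<beta>) = ins \<alpha> \<union> ins \<beta> \<union> sym_diff (outs \<alpha>) (outs \<beta>)"
| "ins (Minus \<alpha> \<beta>) = ins \<alpha> \<union> ins \<beta> \<union> sym_diff (outs \<alpha>) (outs \<beta>)"

primrec subexprs :: "('r, 'v, 'd) flif \<Rightarrow> ('r, 'v, 'd) flif set" where
  "subexprs (Rel R xs ys) = {Rel R xs ys}"
| "subexprs (EqVar x y) = {EqVar x y}"
| "subexprs (EqConst x c) = {EqConst x c}"
| "subexprs (AsgVar x y) = {AsgVar x y}"
| "subexprs (AsgConst x c) = {AsgConst x c}"
| "subexprs (Seq \<alpha> \<beta>) = insert (Seq \<alpha> \<beta>) (subexprs \<alpha> \<union> subexprs \<beta>)"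
| "subexprs (Cup \<alpha> \<beta>) = insert (Cup \<alpha> \<beta>) (subexprs \<alpha> \<union> subexprs \<beta>)"
| "subexprs (Minus \<alpha> \<beta>) = insert (Minus \<alpha> \<beta>) (subexprs \<alpha> \<union> subexprs \<beta>)"

definition io_disjoint :: "('r, 'v, 'd) flif \<Rightarrow> bool" where
  "io_disjoint \<alpha> \<longleftrightarrow> (\<forall>\<beta>\<in>subexprs \<alpha>. ins \<beta> \<inter> outs \<beta> = {})"

end

theory Submission
  imports Defs
begin

text \<open>By structural induction, \<open>\<alpha>\<close> is translated to an io-disjoint \<open>\<beta>\<close> that reads every input \<open>x\<close> from
  \<open>\<sigma> x\<close> and writes every output \<open>y\<close> to \<open>\<tau> y\<close>. A composition \<open>\<alpha>1; \<alpha>2\<close> sends the outputs of \<open>\<alpha>1\<close> to fresh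
  variables, from which \<open>\<alpha>2\<close> then reads: this is why \<open>\<sigma>\<close> has to be part of the induction. The operands of
  a union or difference are padded with copies \<open>\<tau> x := \<sigma> x\<close> until they have the same outputs. All auxiliary
  variables are finally reset to a fixed constant; otherwise a difference could separate results that
  agree on the proper outputs.\<close>

text \<open>Writing outputs to new places breaks inertia. A variable that an expression does not
  write keeps its input value, but this value now stays at \<open>\<sigma> x\<close>, while the
  other operand of a union or difference delivers the variable at \<open>\<tau> x\<close>; the
  copies repair this. They read no new inputs, because \<open>ins\<close> already counts the
  symmetric difference of the outputs.

  The harder obstacle is that projecting auxiliary variables away does not commute with difference:
  if both operands reach the same proper result with different leftovers, the difference of the
  translations keeps what the difference of the originals removes. The invariant is therefore not an
  equality of projections but an equivalence: \<beta> runs iff its auxiliary variables all hold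
  \<open>c\<close> and \<alpha> runs on the composed valuations. With the leftovers determined,
  negation passes through. The value of \<open>c\<close> is irrelevant, but it must be the same for
  both operands, so it is fixed throughout the induction.\<close>

text \<open>\<open>run D \<alpha> \<mu> \<kappa>\<close> says that the pair of \<open>\<mu>\<close> and \<open>override_on \<mu> \<kappa> (outs \<alpha>)\<close> belongs to the semantics of \<open>\<alpha>\<close>.
  Since it depends on \<open>\<mu>\<close> only through the inputs and on \<open>\<kappa>\<close> only through the outputs, renaming of
  variables becomes composition of functions.\<close>

primrec run :: "('r \<Rightarrow> 'd list set) \<Rightarrow> ('r, 'v, 'd) flif \<Rightarrow> ('v \<Rightarrow> 'd) \<Rightarrow> ('v \<Rightarrow> 'd) \<Rightarrow> bool" where
  "run D (Rel R xs ys) \<mu> \<kappa> \<longleftrightarrow> map \<mu> xs @ map \<kappa> ys \<in> D R"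
| "run D (EqVar x y) \<mu> \<kappa> \<longleftrightarrow> \<mu> x = \<mu> y"
| "run D (EqConst x c) \<mu> \<kappa> \<longleftrightarrow> \<mu> x = c"
| "run D (AsgVar x y) \<mu> \<kappa> \<longleftrightarrow> \<kappa> x = \<mu> y"
| "run D (AsgConst x c) \<mu> \<kappa> \<longleftrightarrow> \<kappa> x = c"
| "run D (Seq \<alpha> \<beta>) \<mu> \<kappa> \<longleftrightarrow> (\<exists>\<kappa>'. run D \<alpha> \<mu> \<kappa>' \<and> run D \<beta> (override_on \<mu> \<kappa>' (outs \<alpha>)) \<kappa> \<and>
     (\<forall>v\<in>outs \<alpha> - outs \<beta>. \<kappa>' v = \<kappa> v))"
| "run D (Cup \<alpha> \<beta>) \<mu> \<kappa> \<longleftrightarrow> run D \<alpha> \<mu> \<kappa> \<and> (\<forall>v\<in>outs \<beta> - outs \<alpha>. \<kappa> v = \<mu> v) \<or>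
     run D \<beta> \<mu> \<kappa> \<and> (\<forall>v\<in>outs \<alpha> - outs \<beta>. \<kappa> v = \<mu> v)"
| "run D (Minus \<alpha> \<beta>) \<mu> \<kappa> \<longleftrightarrow> run D \<alpha> \<mu> \<kappa> \<and>
     \<not> (run D \<beta> \<mu> (override_on \<mu> \<kappa> (outs \<alpha>)) \<and> (\<forall>v\<in>outs \<alpha> - outs \<beta>. \<kappa> v = \<mu> v))"

section \<open>The semantics in terms of inputs and outputs\<close>

lemma outs_subset_vars: "outs \<alpha> \<subseteq> vars \<alpha>"
  by (induction \<alpha>) auto

lemma ins_subset_vars: "ins \<alpha> \<subseteq> vars \<alpha>"
  by (induction \<alpha>) (use outs_subset_vars in fastforce)+

lemma finite_vars: "finite (vars \<alpha>)"
  by (induction \<alpha>) auto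

lemma finite_outs: "finite (outs \<alpha>)"
  using finite_subset[OF outs_subset_vars finite_vars] .

text \<open>The union and difference clauses of \<open>run\<close> consult \<mu> directly only on
  the symmetric difference of the outputs, which \<open>ins\<close> counts as input. In a
  composition, the inputs of \<open>\<alpha>2\<close> that \<open>\<alpha>1\<close> writes come from
  the same intermediate valuation on both sides.\<close>

lemma run_cong:
  assumes "\<And>v. v \<in> ins \<alpha> \<Longrightarrow> \<mu> v = \<mu>' v" "\<And>v. v \<in> outs \<alpha> \<Longrightarrow> \<kappa> v = \<kappa>' v"
  shows "run D \<alpha> \<mu> \<kappa> \<longleftrightarrow> run D \<alpha> \<mu>' \<kappa>'"
  using assms
proof (induction \<alpha> arbitrary: \<mu> \<mu>' \<kappa> \<kappa>')
  case (Rel R xs ys)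
  then have "map \<mu> xs = map \<mu>' xs" "map \<kappa> ys = map \<kappa>' ys"
    by auto
  then show ?case by (simp del: map_eq_conv)
next
  case (Seq \<alpha>1 \<alpha>2)
  have 1: "run D \<alpha>1 \<mu> \<eta> \<longleftrightarrow> run D \<alpha>1 \<mu>' \<eta>" for \<eta>
    using Seq.prems by (intro Seq.IH(1)) auto
  have 2: "run D \<alpha>2 (override_on \<mu> \<eta> (outs \<alpha>1)) \<kappa> \<longleftrightarrow>
      run D \<alpha>2 (override_on \<mu>' \<eta> (outs \<alpha>1)) \<kappa>'" for \<eta>
    using Seq.prems by (intro Seq.IH(2)) (auto simp: override_on_def)
  show ?case using Seq.prems by (simp add: 1 2)
next
  case (Cup \<alpha>1 \<alpha>2)
  have "run D \<alpha>1 \<mu> \<kappa> \<longleftrightarrow> run D \<alpha>1 \<mu>' \<kappa>'" "run D \<alpha>2 \<mu> \<kappa> \<longleftrightarrow> run D \<alpha>2 \<mu>' \<kappa>'"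
    using Cup.prems by (intro Cup.IH; auto)+
  then show ?case using Cup.prems by simp
next
  case (Minus \<alpha>1 \<alpha>2)
  have "run D \<alpha>1 \<mu> \<kappa> \<longleftrightarrow> run D \<alpha>1 \<mu>' \<kappa>'"
    using Minus.prems by (intro Minus.IH; auto)
  moreover have "run D \<alpha>2 \<mu> (override_on \<mu> \<kappa> (outs \<alpha>1)) \<longleftrightarrow>
      run D \<alpha>2 \<mu>' (override_on \<mu>' \<kappa>' (outs \<alpha>1))"
    using Minus.prems by (intro Minus.IH) (auto simp: override_on_def)
  ultimately show ?case using Minus.prems by simp
qed auto

text \<open>Inertia can be stated for all \<open>v\<close>, not only for those in \<open>V\<close>,
  because valuations are \<open>undefined\<close> outside \<open>V\<close>.\<close>

lemma sem_iff_run: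
  assumes "vars \<alpha> \<subseteq> V"
  shows "(\<mu>, \<nu>) \<in> sem V D \<alpha> \<longleftrightarrow>
    \<mu> \<in> valuations V \<and> (\<forall>v. v \<notin> outs \<alpha> \<longrightarrow> \<nu> v = \<mu> v) \<and> run D \<alpha> \<mu> \<nu>"
  using assms
proof (induction \<alpha> arbitrary: \<mu> \<nu>)
  case (Rel R xs ys)
  then show ?case
    by (auto simp: valuations_def PiE_def extensional_def) (metis DiffI)
next
  case (Seq \<alpha>1 \<alpha>2)
  show ?case
  proof
    assume "(\<mu>, \<nu>) \<in> sem V D (Seq \<alpha>1 \<alpha>2)"
    then obtain \<eta> where "(\<mu>, \<eta>) \<in> sem V D \<alpha>1" "(\<eta>, \<nu>) \<in> sem V D \<alpha>2"
      by auto
    with Seq have \<eta>: "\<mu> \<in> valuations V" "\<And>v. v \<notin> outs \<alpha>1 \<Longrightarrow> \<eta> v = \<mu> v" "run D \<alpha>1 \<mu> \<eta>"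
      "\<And>v. v \<notin> outs \<alpha>2 \<Longrightarrow> \<nu> v = \<eta> v" "run D \<alpha>2 \<eta> \<nu>"
      by auto
    moreover have "override_on \<mu> \<eta> (outs \<alpha>1) = \<eta>"
      using \<eta> by (auto simp: override_on_def)
    ultimately show "\<mu> \<in> valuations V \<and> (\<forall>v. v \<notin> outs (Seq \<alpha>1 \<alpha>2) \<longrightarrow> \<nu> v = \<mu> v) \<and>
        run D (Seq \<alpha>1 \<alpha>2) \<mu> \<nu>"
      by auto
  next
    assume *: "\<mu> \<in> valuations V \<and> (\<forall>v. v \<notin> outs (Seq \<alpha>1 \<alpha>2) \<longrightarrow> \<nu> v = \<mu> v) \<and>
        run D (Seq \<alpha>1 \<alpha>2) \<mu> \<nu>"
    then obtain \<eta> where \<eta>: "run D \<alpha>1 \<mu> \<eta>" "run D \<alpha>2 (override_on \<mu> \<eta> (outs \<alpha>1)) \<nu>"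
      "\<And>v. v \<in> outs \<alpha>1 - outs \<alpha>2 \<Longrightarrow> \<eta> v = \<nu> v"
      by auto
    \<comment> \<open>\<open>run\<close> leaves \<eta> arbitrary off the outputs of
      \<open>\<alpha>1\<close>; an intermediate valuation must equal \<mu> there.\<close>
    define \<theta> where "\<theta> = override_on \<mu> \<eta> (outs \<alpha>1)"
    have "run D \<alpha>1 \<mu> \<theta>"
      using \<eta>(1) run_cong[of \<alpha>1 \<mu> \<mu> \<eta> \<theta> D] by (simp add: \<theta>_def)
    then have "(\<mu>, \<theta>) \<in> sem V D \<alpha>1"
      using * Seq by (auto simp: \<theta>_def)
    moreover have "outs \<alpha>1 \<subseteq> V"
      using Seq.prems outs_subset_vars[of \<alpha>1] by auto
    then have "\<theta> \<in> valuations V"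
      using * by (auto simp: \<theta>_def valuations_def PiE_def extensional_def override_on_def)
    then have "(\<theta>, \<nu>) \<in> sem V D \<alpha>2"
      using * \<eta> Seq by (auto simp: \<theta>_def override_on_def)
    ultimately show "(\<mu>, \<nu>) \<in> sem V D (Seq \<alpha>1 \<alpha>2)"
      by auto
  qed
next
  case (Minus \<alpha>1 \<alpha>2)
  have "override_on \<mu> \<nu> (outs \<alpha>1) = \<nu>" if "\<forall>v. v \<notin> outs \<alpha>1 \<longrightarrow> \<nu> v = \<mu> v"
    using that by (auto simp: override_on_def)
  moreover have "(\<forall>v. v \<notin> outs \<alpha>2 \<longrightarrow> \<nu> v = \<mu> v) \<longleftrightarrow> (\<forall>v\<in>outs \<alpha>1 - outs \<alpha>2. \<nu> v = \<mu> v)"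
    if "\<forall>v. v \<notin> outs \<alpha>1 \<longrightarrow> \<nu> v = \<mu> v"
    using that by auto
  ultimately show ?case using Minus by auto
qed auto

section \<open>Io-disjoint expressions extended by copies and resets\<close>

lemma io_disjoint_simps [simp]:
  "io_disjoint (Rel R xs ys) \<longleftrightarrow> set xs \<inter> set ys = {}"
  "io_disjoint (EqVar x y)"
  "io_disjoint (EqConst x c)"
  "io_disjoint (AsgVar x y) \<longleftrightarrow> x \<noteq> y"
  "io_disjoint (AsgConst x c)"
  "io_disjoint (Seq \<alpha> \<beta>) \<longleftrightarrow> io_disjoint \<alpha> \<and> io_disjoint \<beta> \<and> ins (Seq \<alpha> \<beta>) \<inter> outs (Seq \<alpha> \<beta>) = {}"
  "io_disjoint (Cup \<alpha> \<beta>) \<longleftrightarrow> io_disjoint \<alpha> \<and> io_disjoint \<beta> \<and> ins (Cup \<alpha> \<beta>) \<inter> outs (Cup \<alpha> \<beta>) = {}"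
  "io_disjoint (Minus \<alpha> \<beta>) \<longleftrightarrow>
     io_disjoint \<alpha> \<and> io_disjoint \<beta> \<and> ins (Minus \<alpha> \<beta>) \<inter> outs (Minus \<alpha> \<beta>) = {}"
  by (auto simp: io_disjoint_def)

lemma io_disjointD: "io_disjoint \<alpha> \<Longrightarrow> ins \<alpha> \<inter> outs \<alpha> = {}"
  by (cases \<alpha>) auto

text \<open>\<open>override_on \<nu> \<kappa> (outs \<beta>) (\<sigma> x)\<close> is the value of
  \<open>\<sigma> x\<close> after \<beta>. There are two uses: padding copies from variables that
  \<beta> does not write, which yields input values, and composition copies from outputs of \<beta>.
  No target is a source or is read or written by \<beta>, so the copies do not interfere and
  io-disjointness survives.\<close>

lemma ex_copy:
  fixes \<beta> :: "('r, 'v, 'd) flif"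
  assumes "finite X" "inj_on \<tau> X" "\<tau> ` X \<inter> (outs \<beta> \<union> ins \<beta> \<union> \<sigma> ` X) = {}"
    "io_disjoint \<beta>" "is_flif S \<beta>"
  shows "\<exists>\<beta>'. is_flif S \<beta>' \<and> io_disjoint \<beta>' \<and> outs \<beta>' = outs \<beta> \<union> \<tau> ` X \<and>
    ins \<beta>' = ins \<beta> \<union> (\<sigma> ` X - outs \<beta>) \<and>
    (\<forall>D \<nu> \<kappa>. run D \<beta>' \<nu> \<kappa> \<longleftrightarrow>
      run D \<beta> \<nu> \<kappa> \<and> (\<forall>x\<in>X. \<kappa> (\<tau> x) = override_on \<nu> \<kappa> (outs \<beta>) (\<sigma> x)))"
  using assms
proof (induction X)
  case empty
  then show ?case by auto
next
  case (insert x X)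
  then obtain \<beta>' where \<beta>': "is_flif S \<beta>'" "io_disjoint \<beta>'" "outs \<beta>' = outs \<beta> \<union> \<tau> ` X"
    "ins \<beta>' = ins \<beta> \<union> (\<sigma> ` X - outs \<beta>)"
    "\<And>D \<nu> \<kappa>. run D \<beta>' \<nu> \<kappa> \<longleftrightarrow>
      run D \<beta> \<nu> \<kappa> \<and> (\<forall>x\<in>X. \<kappa> (\<tau> x) = override_on \<nu> \<kappa> (outs \<beta>) (\<sigma> x))"
    by auto
  let ?\<gamma> = "Seq \<beta>' (AsgVar (\<tau> x) (\<sigma> x)) :: ('r, 'v, 'd) flif"
  have fresh: "\<tau> x \<notin> outs \<beta>'" "\<sigma> x \<notin> \<tau> ` X" "\<sigma> x \<noteq> \<tau> x"
    using insert by (auto simp: \<beta>')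
  have "run D ?\<gamma> \<nu> \<kappa> \<longleftrightarrow> run D \<beta>' \<nu> \<kappa> \<and> \<kappa> (\<tau> x) = override_on \<nu> \<kappa> (outs \<beta>) (\<sigma> x)" for D \<nu> \<kappa>
  proof -
    \<comment> \<open>As \<open>\<tau> x\<close> is not an output of \<open>\<beta>'\<close>, the
      intermediate \<open>\<kappa>'\<close> agrees with \<kappa> on all outputs of
      \<open>\<beta>'\<close>; hence \<kappa> itself can serve as the intermediate
      valuation.\<close>
    have "run D \<beta>' \<nu> \<kappa>"
      if "run D \<beta>' \<nu> \<kappa>'" "\<forall>v\<in>outs \<beta>'. \<kappa>' v = \<kappa> v" for \<kappa>'
      using that run_cong[of \<beta>' \<nu> \<nu> \<kappa>' \<kappa> D] by auto
    then have "run D ?\<gamma> \<nu> \<kappa> \<longleftrightarrow> run D \<beta>' \<nu> \<kappa> \<and> \<kappa> (\<tau> x) = override_on \<nu> \<kappa> (outs \<beta>') (\<sigma> x)"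
      using fresh(1) by (fastforce simp: override_on_def)
    then show ?thesis
      using fresh(2) by (simp add: \<beta>'(3) override_on_def)
  qed
  then have "\<forall>D \<nu> \<kappa>. run D ?\<gamma> \<nu> \<kappa> \<longleftrightarrow> run D \<beta> \<nu> \<kappa> \<and>
      (\<forall>x\<in>insert x X. \<kappa> (\<tau> x) = override_on \<nu> \<kappa> (outs \<beta>) (\<sigma> x))"
    unfolding \<beta>'(5) by blast
  moreover have "io_disjoint ?\<gamma>"
    using insert.prems fresh \<beta>'(1-4) io_disjointD[of \<beta>] by auto
  moreover have "outs ?\<gamma> = outs \<beta> \<union> \<tau> ` insert x X" "ins ?\<gamma> = ins \<beta> \<union> (\<sigma> ` insert x X - outs \<beta>)"
    using fresh(2) \<beta>'(3,4) by auto
  moreover have "is_flif S ?\<gamma>"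
    using \<beta>'(1) by simp
  ultimately show ?case by blast
qed

text \<open>A reset erases what \<beta> wrote to \<open>Z\<close>; the inner
  \<open>\<exists>\<close> is this projection. \<open>Z\<close> may also contain variables that
  \<beta> does not write: they become outputs with value \<open>c\<close>, which is how one operand
  acquires the auxiliary variables of the other.\<close>

lemma ex_reset:
  fixes \<beta> :: "('r, 'v, 'd) flif"
  assumes "finite Z" "Z \<inter> ins \<beta> = {}" "io_disjoint \<beta>" "is_flif S \<beta>"
  shows "\<exists>\<beta>'. is_flif S \<beta>' \<and> io_disjoint \<beta>' \<and> outs \<beta>' = outs \<beta> \<union> Z \<and> ins \<beta>' = ins \<beta> \<and>
    (\<forall>D \<nu> \<kappa>. run D \<beta>' \<nu> \<kappa> \<longleftrightarrow>
      (\<forall>z\<in>Z. \<kappa> z = c) \<and> (\<exists>\<kappa>'. (\<forall>v. v \<notin> Z \<longrightarrow> \<kappa>' v = \<kappa> v) \<and> run D \<beta> \<nu> \<kappa>'))"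
  using assms
proof (induction Z)
  case empty
  have "(\<exists>\<kappa>'. (\<forall>v. \<kappa>' v = \<kappa> v) \<and> run D \<beta> \<nu> \<kappa>') \<longleftrightarrow> run D \<beta> \<nu> \<kappa>" for D \<nu> \<kappa>
    by (auto simp flip: fun_eq_iff)
  then show ?case using empty by auto
next
  case (insert z Z)
  then obtain \<beta>' where \<beta>': "is_flif S \<beta>'" "io_disjoint \<beta>'" "outs \<beta>' = outs \<beta> \<union> Z" "ins \<beta>' = ins \<beta>"
    "\<And>D \<nu> \<kappa>. run D \<beta>' \<nu> \<kappa> \<longleftrightarrow>
      (\<forall>z\<in>Z. \<kappa> z = c) \<and> (\<exists>\<kappa>'. (\<forall>v. v \<notin> Z \<longrightarrow> \<kappa>' v = \<kappa> v) \<and> run D \<beta> \<nu> \<kappa>')"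
    by auto
  let ?\<gamma> = "Seq \<beta>' (AsgConst z c) :: ('r, 'v, 'd) flif"
  have "run D ?\<gamma> \<nu> \<kappa> \<longleftrightarrow>
      (\<forall>z\<in>insert z Z. \<kappa> z = c) \<and> (\<exists>\<kappa>'. (\<forall>v. v \<notin> insert z Z \<longrightarrow> \<kappa>' v = \<kappa> v) \<and> run D \<beta> \<nu> \<kappa>')"
    (is "?L \<longleftrightarrow> ?R") for D \<nu> \<kappa>
  proof
    assume ?L
    then obtain \<kappa>1 where 1: "run D \<beta>' \<nu> \<kappa>1" "\<kappa> z = c" "\<And>v. v \<in> outs \<beta>' \<Longrightarrow> v \<noteq> z \<Longrightarrow> \<kappa>1 v = \<kappa> v"
      by auto
    then obtain \<kappa>2 where 2: "\<And>v. v \<notin> Z \<Longrightarrow> \<kappa>2 v = \<kappa>1 v" "run D \<beta> \<nu> \<kappa>2" "\<And>v. v \<in> Z \<Longrightarrow> \<kappa>1 v = c"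
      unfolding \<beta>' by auto
    \<comment> \<open>\<open>\<kappa>2\<close> may differ from \<kappa> at non-outputs, which the
      run does not constrain. Keeping \<kappa> outside \<open>insert z Z\<close> restores the
      agreement that the projection asks for.\<close>
    have "run D \<beta> \<nu> (override_on \<kappa> \<kappa>2 (insert z Z))"
      using 2(2) 1 2(1) run_cong[of \<beta> \<nu> \<nu> \<kappa>2 "override_on \<kappa> \<kappa>2 (insert z Z)" D]
      by (auto simp: override_on_def \<beta>')
    then have "\<exists>\<kappa>'. (\<forall>v. v \<notin> insert z Z \<longrightarrow> \<kappa>' v = \<kappa> v) \<and> run D \<beta> \<nu> \<kappa>'"
      by (intro exI[of _ "override_on \<kappa> \<kappa>2 (insert z Z)"]) auto
    moreover have "\<forall>z\<in>insert z Z. \<kappa> z = c"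
      using 1(2) 1(3) 2(3) insert.hyps by (metis UnCI \<beta>'(3) insert_iff)
    ultimately show ?R by blast
  next
    assume ?R
    then obtain \<kappa>2 where 2: "\<And>v. v \<notin> insert z Z \<Longrightarrow> \<kappa>2 v = \<kappa> v" "run D \<beta> \<nu> \<kappa>2"
      and c: "\<kappa> z = c" "\<And>z. z \<in> Z \<Longrightarrow> \<kappa> z = c"
      by auto
    \<comment> \<open>Only the last reset is undone: \<open>z\<close> gets back its value in
      \<open>\<kappa>2\<close>, while \<open>Z\<close> stays at \<open>c\<close>.\<close>
    have "run D \<beta>' \<nu> (\<kappa>(z := \<kappa>2 z))"
      unfolding \<beta>' using 2 c insert.hyps by auto
    then show ?L using c by (auto intro!: exI[of _ "\<kappa>(z := \<kappa>2 z)"] split: if_splits)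
  qed
  then show ?case
    using insert.prems \<beta>'(1-4) io_disjointD[of \<beta>] by (intro exI[of _ ?\<gamma>]) auto
qed

lemma obtain_reset:
  fixes \<beta> :: "('r, 'v, 'd) flif"
  assumes "finite Z" "Z \<inter> ins \<beta> = {}" "io_disjoint \<beta>" "is_flif S \<beta>"
  obtains \<beta>' where "is_flif S \<beta>'" "io_disjoint \<beta>'" "outs \<beta>' = outs \<beta> \<union> Z" "ins \<beta>' = ins \<beta>"
    "\<forall>D \<nu> \<kappa>. run D \<beta>' \<nu> \<kappa> \<longleftrightarrow>
      (\<forall>z\<in>Z. \<kappa> z = c) \<and> (\<exists>\<kappa>'. (\<forall>v. v \<notin> Z \<longrightarrow> \<kappa>' v = \<kappa> v) \<and> run D \<beta> \<nu> \<kappa>')"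
  using ex_reset[OF assms, of c] by auto

section \<open>Fresh variables, and operands made equal in their outputs\<close>

lemma ex_fresh_inj:
  fixes A :: "'v set"
  assumes "infinite (UNIV :: 'v set)" "finite A" "finite X"
  shows "\<exists>f :: 'b \<Rightarrow> 'v. inj_on f X \<and> f ` X \<inter> A = {}"
proof -
  have "infinite (- A)"
    using assms by (simp add: Compl_eq_Diff_UNIV)
  then obtain Y where "Y \<subseteq> - A" "finite Y" "card Y = card X"
    by (meson infinite_arbitrarily_large)
  moreover from this obtain f where "bij_betw f X Y"
    using assms by (metis finite_same_card_bij)
  ultimately show ?thesis
    by (auto simp: bij_betw_def)
qed

text \<open>\<open>Z\<close> is the set of auxiliary variables, which must avoid \<open>A\<close>.\<close>

definition reroutes :: "'r schema \<Rightarrow> 'd \<Rightarrow> ('v \<Rightarrow> 'v) \<Rightarrow> ('v \<Rightarrow> 'v) \<Rightarrow> 'v set \<Rightarrow>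
    ('r, 'v, 'd) flif \<Rightarrow> ('r, 'v, 'd) flif \<Rightarrow> 'v set \<Rightarrow> bool" where
  "reroutes S c \<sigma> \<tau> A \<alpha> \<beta> Z \<longleftrightarrow> is_flif S \<beta> \<and> io_disjoint \<beta> \<and> finite Z \<and>
     Z \<inter> (A \<union> \<tau> ` outs \<alpha>) = {} \<and> outs \<beta> = \<tau> ` outs \<alpha> \<union> Z \<and> ins \<beta> = \<sigma> ` ins \<alpha> \<and>
     (\<forall>D \<nu> \<kappa>. run D \<beta> \<nu> \<kappa> \<longleftrightarrow> (\<forall>z\<in>Z. \<kappa> z = c) \<and> run D \<alpha> (\<nu> \<circ> \<sigma>) (\<kappa> \<circ> \<tau>))"

text \<open>The variables of \<open>X\<close> are not written by \<alpha>, so their final values are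
  their input values, found at \<open>\<sigma> x\<close>; the copies deliver them at
  \<open>\<tau> x\<close>, where the other operand writes. \<open>Y\<close> stands for the auxiliary
  variables of that operand.\<close>

lemma ex_reroutes_pad:
  fixes \<alpha> :: "('r, 'v, 'd) flif"
  assumes \<beta>: "reroutes S c \<sigma> \<tau> A \<alpha> \<beta> Z"
    and X: "finite X" "inj_on \<tau> X" "\<tau> ` X \<subseteq> A" "\<tau> ` X \<inter> (\<tau> ` outs \<alpha> \<union> \<sigma> ` ins \<alpha> \<union> \<sigma> ` X) = {}"
      "\<sigma> ` X \<subseteq> A" "\<sigma> ` X \<inter> \<tau> ` outs \<alpha> = {}"
    and Y: "finite Y" "Y \<inter> (\<sigma> ` ins \<alpha> \<union> \<tau> ` outs \<alpha> \<union> \<tau> ` X \<union> \<sigma> ` X \<union> Z) = {}"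
  shows "\<exists>\<beta>'. is_flif S \<beta>' \<and> io_disjoint \<beta>' \<and> outs \<beta>' = \<tau> ` (outs \<alpha> \<union> X) \<union> (Z \<union> Y) \<and>
    ins \<beta>' = \<sigma> ` (ins \<alpha> \<union> X) \<and>
    (\<forall>D \<nu> \<kappa>. run D \<beta>' \<nu> \<kappa> \<longleftrightarrow> (\<forall>z\<in>Z \<union> Y. \<kappa> z = c) \<and> run D \<alpha> (\<nu> \<circ> \<sigma>) (\<kappa> \<circ> \<tau>) \<and>
      (\<forall>x\<in>X. (\<kappa> \<circ> \<tau>) x = (\<nu> \<circ> \<sigma>) x))"
proof -
  note \<beta>' = \<beta>[unfolded reroutes_def]
  have "\<exists>\<gamma>. is_flif S \<gamma> \<and> io_disjoint \<gamma> \<and> outs \<gamma> = outs \<beta> \<union> \<tau> ` X \<and>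
    ins \<gamma> = ins \<beta> \<union> (\<sigma> ` X - outs \<beta>) \<and>
    (\<forall>D \<nu> \<kappa>. run D \<gamma> \<nu> \<kappa> \<longleftrightarrow>
      run D \<beta> \<nu> \<kappa> \<and> (\<forall>x\<in>X. \<kappa> (\<tau> x) = override_on \<nu> \<kappa> (outs \<beta>) (\<sigma> x)))"
    using \<beta>' X by (intro ex_copy) auto
  then obtain \<gamma> where \<gamma>: "is_flif S \<gamma>" "io_disjoint \<gamma>" "outs \<gamma> = outs \<beta> \<union> \<tau> ` X"
    "ins \<gamma> = ins \<beta> \<union> (\<sigma> ` X - outs \<beta>)"
    "\<And>D \<nu> \<kappa>. run D \<gamma> \<nu> \<kappa> \<longleftrightarrow>
      run D \<beta> \<nu> \<kappa> \<and> (\<forall>x\<in>X. \<kappa> (\<tau> x) = override_on \<nu> \<kappa> (outs \<beta>) (\<sigma> x))"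
    by auto
  have notin: "\<sigma> x \<notin> outs \<beta>" if "x \<in> X" for x
    using that X \<beta>' by auto
  then have run_\<gamma>: "run D \<gamma> \<nu> \<kappa> \<longleftrightarrow> run D \<beta> \<nu> \<kappa> \<and> (\<forall>x\<in>X. \<kappa> (\<tau> x) = \<nu> (\<sigma> x))" for D \<nu> \<kappa>
    unfolding \<gamma> by auto
  have ins_\<gamma>: "ins \<gamma> = \<sigma> ` (ins \<alpha> \<union> X)"
    using \<gamma>(4) notin \<beta>' by auto
  have "\<exists>\<delta>. is_flif S \<delta> \<and> io_disjoint \<delta> \<and> outs \<delta> = outs \<gamma> \<union> Y \<and> ins \<delta> = ins \<gamma> \<and>
    (\<forall>D \<nu> \<kappa>. run D \<delta> \<nu> \<kappa> \<longleftrightarrow>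
      (\<forall>z\<in>Y. \<kappa> z = c) \<and> (\<exists>\<kappa>'. (\<forall>v. v \<notin> Y \<longrightarrow> \<kappa>' v = \<kappa> v) \<and> run D \<gamma> \<nu> \<kappa>'))"
    using \<gamma>(1,2) Y by (intro ex_reset) (auto simp: ins_\<gamma>)
  then obtain \<delta> where \<delta>: "is_flif S \<delta>" "io_disjoint \<delta>" "outs \<delta> = outs \<gamma> \<union> Y" "ins \<delta> = ins \<gamma>"
    "\<And>D \<nu> \<kappa>. run D \<delta> \<nu> \<kappa> \<longleftrightarrow>
      (\<forall>z\<in>Y. \<kappa> z = c) \<and> (\<exists>\<kappa>'. (\<forall>v. v \<notin> Y \<longrightarrow> \<kappa>' v = \<kappa> v) \<and> run D \<gamma> \<nu> \<kappa>')"
    by auto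
  \<comment> \<open>\<open>Y\<close> meets no output of \<gamma>, so the projection introduced by
    the reset is vacuous.\<close>
  have "(\<exists>\<kappa>'. (\<forall>v. v \<notin> Y \<longrightarrow> \<kappa>' v = \<kappa> v) \<and> run D \<gamma> \<nu> \<kappa>') \<longleftrightarrow> run D \<gamma> \<nu> \<kappa>" for D \<nu> \<kappa>
  proof -
    have "run D \<gamma> \<nu> \<kappa>' \<longleftrightarrow> run D \<gamma> \<nu> \<kappa>" if "\<forall>v. v \<notin> Y \<longrightarrow> \<kappa>' v = \<kappa> v" for \<kappa>'
      using that Y \<beta>' by (intro run_cong) (auto simp: \<gamma>)
    then show ?thesis by blast
  qed
  then have "run D \<delta> \<nu> \<kappa> \<longleftrightarrow> (\<forall>z\<in>Z \<union> Y. \<kappa> z = c) \<and> run D \<alpha> (\<nu> \<circ> \<sigma>) (\<kappa> \<circ> \<tau>) \<and>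
      (\<forall>x\<in>X. (\<kappa> \<circ> \<tau>) x = (\<nu> \<circ> \<sigma>) x)" for D \<nu> \<kappa>
    unfolding \<delta> run_\<gamma> using \<beta>' by auto
  moreover have "outs \<delta> = \<tau> ` (outs \<alpha> \<union> X) \<union> (Z \<union> Y)"
    using \<delta> \<gamma> \<beta>' by auto
  ultimately show ?thesis
    using \<delta> ins_\<gamma> by (intro exI[of _ \<delta>]) simp
qed

text \<open>This is the common part of union and difference. Equal outputs of
  \<open>\<gamma>1\<close> and \<open>\<gamma>2\<close> empty both the symmetric difference in
  \<open>ins\<close> and the inertia conditions in \<open>run\<close>, so combining the two adds no
  inputs and acts on runs as plain disjunction or negated conjunct.\<close>

lemma ex_reroutes_pair:
  fixes \<alpha>1 \<alpha>2 :: "('r, 'v, 'd) flif"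
  defines "I \<equiv> ins \<alpha>1 \<union> ins \<alpha>2 \<union> sym_diff (outs \<alpha>1) (outs \<alpha>2)" and "O' \<equiv> outs \<alpha>1 \<union> outs \<alpha>2"
  assumes 1: "\<forall>A. finite A \<longrightarrow> (\<exists>\<beta> Z. reroutes S c \<sigma> \<tau> A \<alpha>1 \<beta> Z)"
    and 2: "\<forall>A. finite A \<longrightarrow> (\<exists>\<beta> Z. reroutes S c \<sigma> \<tau> A \<alpha>2 \<beta> Z)"
    and A: "finite A" and inj: "inj_on \<tau> O'" and disj: "\<sigma> ` I \<inter> \<tau> ` O' = {}"
  obtains \<gamma>1 \<gamma>2 Z where "is_flif S \<gamma>1" "is_flif S \<gamma>2" "io_disjoint \<gamma>1" "io_disjoint \<gamma>2"
    "finite Z" "Z \<inter> (A \<union> \<tau> ` O' \<union> \<sigma> ` I) = {}"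
    "outs \<gamma>1 = \<tau> ` O' \<union> Z" "outs \<gamma>2 = \<tau> ` O' \<union> Z" "ins \<gamma>1 \<union> ins \<gamma>2 = \<sigma> ` I"
    "\<forall>D \<nu> \<kappa>. run D \<gamma>1 \<nu> \<kappa> \<longleftrightarrow> (\<forall>z\<in>Z. \<kappa> z = c) \<and> run D \<alpha>1 (\<nu> \<circ> \<sigma>) (\<kappa> \<circ> \<tau>) \<and>
      (\<forall>x\<in>outs \<alpha>2 - outs \<alpha>1. (\<kappa> \<circ> \<tau>) x = (\<nu> \<circ> \<sigma>) x)"
    "\<forall>D \<nu> \<kappa>. run D \<gamma>2 \<nu> \<kappa> \<longleftrightarrow> (\<forall>z\<in>Z. \<kappa> z = c) \<and> run D \<alpha>2 (\<nu> \<circ> \<sigma>) (\<kappa> \<circ> \<tau>) \<and>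
      (\<forall>x\<in>outs \<alpha>1 - outs \<alpha>2. (\<kappa> \<circ> \<tau>) x = (\<nu> \<circ> \<sigma>) x)"
proof -
  \<comment> \<open>Avoiding \<open>A\<close> is not enough: the auxiliary variables of one operand
    must also miss the inputs and outputs of the other, those of the copies included.\<close>
  define B where "B = A \<union> \<tau> ` O' \<union> \<sigma> ` I"
  have fin: "finite O'" "finite I"
    using finite_outs[of \<alpha>1] finite_outs[of \<alpha>2] finite_subset[OF ins_subset_vars finite_vars]
    by (auto simp: I_def O'_def)
  then have "finite B"
    using A by (auto simp: B_def)
  with 1 obtain \<beta>1 Z1 where \<beta>1: "reroutes S c \<sigma> \<tau> B \<alpha>1 \<beta>1 Z1"
    by blast
  then have Z1: "finite Z1" "Z1 \<inter> B = {}"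
    by (auto simp: reroutes_def)
  \<comment> \<open>\<open>Z2\<close> has to avoid \<open>Z1\<close> because each operand will reset
    the auxiliary variables of the other as new outputs.\<close>
  with 2[rule_format, of "B \<union> Z1"] \<open>finite B\<close> obtain \<beta>2 Z2 where \<beta>2': "reroutes S c \<sigma> \<tau> (B \<union> Z1) \<alpha>2 \<beta>2 Z2"
    by blast
  then have Z2: "finite Z2" "Z2 \<inter> (B \<union> Z1) = {}"
    by (auto simp: reroutes_def)
  have \<beta>2: "reroutes S c \<sigma> \<tau> B \<alpha>2 \<beta>2 Z2"
    using \<beta>2' by (auto simp: reroutes_def)
  have inj': "\<tau> ` (outs \<alpha>2 - outs \<alpha>1) \<inter> \<tau> ` outs \<alpha>1 = {}" "\<tau> ` (outs \<alpha>1 - outs \<alpha>2) \<inter> \<tau> ` outs \<alpha>2 = {}"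
    using inj by (auto simp: O'_def inj_on_def)
  have sub: "ins \<alpha>1 \<subseteq> I" "ins \<alpha>2 \<subseteq> I" "outs \<alpha>1 \<subseteq> O'" "outs \<alpha>2 \<subseteq> O'"
    "outs \<alpha>2 - outs \<alpha>1 \<subseteq> I" "outs \<alpha>1 - outs \<alpha>2 \<subseteq> I"
    by (auto simp: I_def O'_def)
  have im: "\<sigma> ` ins \<alpha>1 \<subseteq> \<sigma> ` I" "\<sigma> ` ins \<alpha>2 \<subseteq> \<sigma> ` I" "\<tau> ` outs \<alpha>1 \<subseteq> \<tau> ` O'" "\<tau> ` outs \<alpha>2 \<subseteq> \<tau> ` O'"
    "\<sigma> ` (outs \<alpha>2 - outs \<alpha>1) \<subseteq> \<sigma> ` I" "\<sigma> ` (outs \<alpha>1 - outs \<alpha>2) \<subseteq> \<sigma> ` I"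
    "\<tau> ` (outs \<alpha>2 - outs \<alpha>1) \<subseteq> \<tau> ` O'" "\<tau> ` (outs \<alpha>1 - outs \<alpha>2) \<subseteq> \<tau> ` O'"
    using sub by blast+
  have B: "\<sigma> ` I \<subseteq> B" "\<tau> ` O' \<subseteq> B"
    by (auto simp: B_def)
  have disjoint: "P \<inter> Q = {}" "Q \<inter> P = {}" if "P \<subseteq> \<sigma> ` I" "Q \<subseteq> \<tau> ` O'" for P Q
    using disj that by blast+
  have fresh: "Z1 \<inter> P = {}" "Z2 \<inter> P = {}" if "P \<subseteq> \<sigma> ` I \<or> P \<subseteq> \<tau> ` O'" for P
    using Z1 Z2 B that by blast+
  have "Z1 \<inter> Z2 = {}" "Z2 \<inter> Z1 = {}"
    using Z2 by blast+
  have "\<exists>\<gamma>1. is_flif S \<gamma>1 \<and> io_disjoint \<gamma>1 \<and>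
    outs \<gamma>1 = \<tau> ` (outs \<alpha>1 \<union> (outs \<alpha>2 - outs \<alpha>1)) \<union> (Z1 \<union> Z2) \<and>
    ins \<gamma>1 = \<sigma> ` (ins \<alpha>1 \<union> (outs \<alpha>2 - outs \<alpha>1)) \<and>
    (\<forall>D \<nu> \<kappa>. run D \<gamma>1 \<nu> \<kappa> \<longleftrightarrow> (\<forall>z\<in>Z1 \<union> Z2. \<kappa> z = c) \<and> run D \<alpha>1 (\<nu> \<circ> \<sigma>) (\<kappa> \<circ> \<tau>) \<and>
      (\<forall>x\<in>outs \<alpha>2 - outs \<alpha>1. (\<kappa> \<circ> \<tau>) x = (\<nu> \<circ> \<sigma>) x))"
  proof (rule ex_reroutes_pad[OF \<beta>1])
    show "inj_on \<tau> (outs \<alpha>2 - outs \<alpha>1)"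
      using inj sub by (meson Diff_subset inj_on_subset)
    show "finite (outs \<alpha>2 - outs \<alpha>1)" by (simp add: finite_outs)
    show "\<tau> ` (outs \<alpha>2 - outs \<alpha>1) \<subseteq> B" "\<sigma> ` (outs \<alpha>2 - outs \<alpha>1) \<subseteq> B"
      using im B by (meson order_trans)+
    show "\<tau> ` (outs \<alpha>2 - outs \<alpha>1) \<inter>
        (\<tau> ` outs \<alpha>1 \<union> \<sigma> ` ins \<alpha>1 \<union> \<sigma> ` (outs \<alpha>2 - outs \<alpha>1)) = {}"
      unfolding Int_Un_distrib Un_empty using disjoint inj' by (meson im)
    show "\<sigma> ` (outs \<alpha>2 - outs \<alpha>1) \<inter> \<tau> ` outs \<alpha>1 = {}"
      using disjoint im by meson
    show "finite Z2" by fact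
    show "Z2 \<inter> (\<sigma> ` ins \<alpha>1 \<union> \<tau> ` outs \<alpha>1 \<union> \<tau> ` (outs \<alpha>2 - outs \<alpha>1) \<union>
        \<sigma> ` (outs \<alpha>2 - outs \<alpha>1) \<union> Z1) = {}"
      unfolding Int_Un_distrib Un_empty using fresh im \<open>Z1 \<inter> Z2 = {}\<close> \<open>Z2 \<inter> Z1 = {}\<close> by meson
  qed
  then obtain \<gamma>1 where \<gamma>1: "is_flif S \<gamma>1" "io_disjoint \<gamma>1"
    "outs \<gamma>1 = \<tau> ` (outs \<alpha>1 \<union> (outs \<alpha>2 - outs \<alpha>1)) \<union> (Z1 \<union> Z2)"
    "ins \<gamma>1 = \<sigma> ` (ins \<alpha>1 \<union> (outs \<alpha>2 - outs \<alpha>1))"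
    "\<forall>D \<nu> \<kappa>. run D \<gamma>1 \<nu> \<kappa> \<longleftrightarrow> (\<forall>z\<in>Z1 \<union> Z2. \<kappa> z = c) \<and> run D \<alpha>1 (\<nu> \<circ> \<sigma>) (\<kappa> \<circ> \<tau>) \<and>
      (\<forall>x\<in>outs \<alpha>2 - outs \<alpha>1. (\<kappa> \<circ> \<tau>) x = (\<nu> \<circ> \<sigma>) x)"
    by auto
  have "\<exists>\<gamma>2. is_flif S \<gamma>2 \<and> io_disjoint \<gamma>2 \<and>
    outs \<gamma>2 = \<tau> ` (outs \<alpha>2 \<union> (outs \<alpha>1 - outs \<alpha>2)) \<union> (Z2 \<union> Z1) \<and>
    ins \<gamma>2 = \<sigma> ` (ins \<alpha>2 \<union> (outs \<alpha>1 - outs \<alpha>2)) \<and>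
    (\<forall>D \<nu> \<kappa>. run D \<gamma>2 \<nu> \<kappa> \<longleftrightarrow> (\<forall>z\<in>Z2 \<union> Z1. \<kappa> z = c) \<and> run D \<alpha>2 (\<nu> \<circ> \<sigma>) (\<kappa> \<circ> \<tau>) \<and>
      (\<forall>x\<in>outs \<alpha>1 - outs \<alpha>2. (\<kappa> \<circ> \<tau>) x = (\<nu> \<circ> \<sigma>) x))"
  proof (rule ex_reroutes_pad[OF \<beta>2])
    show "inj_on \<tau> (outs \<alpha>1 - outs \<alpha>2)"
      using inj sub by (meson Diff_subset inj_on_subset)
    show "finite (outs \<alpha>1 - outs \<alpha>2)" by (simp add: finite_outs)
    show "\<tau> ` (outs \<alpha>1 - outs \<alpha>2) \<subseteq> B" "\<sigma> ` (outs \<alpha>1 - outs \<alpha>2) \<subseteq> B"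
      using im B by (meson order_trans)+
    show "\<tau> ` (outs \<alpha>1 - outs \<alpha>2) \<inter>
        (\<tau> ` outs \<alpha>2 \<union> \<sigma> ` ins \<alpha>2 \<union> \<sigma> ` (outs \<alpha>1 - outs \<alpha>2)) = {}"
      unfolding Int_Un_distrib Un_empty using disjoint inj' by (meson im)
    show "\<sigma> ` (outs \<alpha>1 - outs \<alpha>2) \<inter> \<tau> ` outs \<alpha>2 = {}"
      using disjoint im by meson
    show "finite Z1" by fact
    show "Z1 \<inter> (\<sigma> ` ins \<alpha>2 \<union> \<tau> ` outs \<alpha>2 \<union> \<tau> ` (outs \<alpha>1 - outs \<alpha>2) \<union>
        \<sigma> ` (outs \<alpha>1 - outs \<alpha>2) \<union> Z2) = {}"
      unfolding Int_Un_distrib Un_empty using fresh im \<open>Z1 \<inter> Z2 = {}\<close> \<open>Z2 \<inter> Z1 = {}\<close> by meson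
  qed
  then obtain \<gamma>2 where \<gamma>2: "is_flif S \<gamma>2" "io_disjoint \<gamma>2"
    "outs \<gamma>2 = \<tau> ` (outs \<alpha>2 \<union> (outs \<alpha>1 - outs \<alpha>2)) \<union> (Z2 \<union> Z1)"
    "ins \<gamma>2 = \<sigma> ` (ins \<alpha>2 \<union> (outs \<alpha>1 - outs \<alpha>2))"
    "\<forall>D \<nu> \<kappa>. run D \<gamma>2 \<nu> \<kappa> \<longleftrightarrow> (\<forall>z\<in>Z2 \<union> Z1. \<kappa> z = c) \<and> run D \<alpha>2 (\<nu> \<circ> \<sigma>) (\<kappa> \<circ> \<tau>) \<and>
      (\<forall>x\<in>outs \<alpha>1 - outs \<alpha>2. (\<kappa> \<circ> \<tau>) x = (\<nu> \<circ> \<sigma>) x)"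
    by auto
  have "(Z1 \<union> Z2) \<inter> (A \<union> \<tau> ` O' \<union> \<sigma> ` I) = {}"
    using Z1 Z2 by (auto simp: B_def)
  moreover have "outs \<gamma>1 = \<tau> ` O' \<union> (Z1 \<union> Z2)" "outs \<gamma>2 = \<tau> ` O' \<union> (Z1 \<union> Z2)"
    using \<gamma>1(3) \<gamma>2(3) by (auto simp: O'_def)
  moreover have "ins \<gamma>1 \<union> ins \<gamma>2 = \<sigma> ` I"
    using \<gamma>1(4) \<gamma>2(4) by (auto simp: I_def)
  ultimately show thesis
    using \<gamma>1(1,2,5) \<gamma>2(1,2,5) Z1 Z2
    by (intro that[of \<gamma>1 \<gamma>2 "Z1 \<union> Z2"]) (simp_all add: Un_commute)
qed

section \<open>The induction steps for composition, union and difference\<close>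

text \<open>Sending the outputs of \<open>\<alpha>1\<close> straight to their \<tau>-places fails
  for a variable that \<open>\<alpha>1\<close> writes and \<open>\<alpha>2\<close> both reads and
  writes: \<open>\<alpha>2\<close> would read and write the same place. The fresh set
  \<open>F\<close> separates the two. In return, outputs of \<open>\<alpha>1\<close> that
  \<open>\<alpha>2\<close> leaves alone must be copied from \<open>F\<close> to their \<tau>-places
  before \<open>F\<close> is reset.\<close>

lemma ex_reroutes_Seq:
  fixes \<alpha>1 \<alpha>2 :: "('r, 'v, 'd) flif"
  assumes infin: "infinite (UNIV :: 'v set)" and A: "finite A"
    and IH1: "\<And>\<sigma> \<tau> A. finite A \<Longrightarrow> inj_on \<tau> (outs \<alpha>1) \<Longrightarrow> \<sigma> ` ins \<alpha>1 \<inter> \<tau> ` outs \<alpha>1 = {} \<Longrightarrow>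
      \<exists>\<beta> Z. reroutes S c \<sigma> \<tau> A \<alpha>1 \<beta> Z"
    and IH2: "\<And>\<sigma> \<tau> A. finite A \<Longrightarrow> inj_on \<tau> (outs \<alpha>2) \<Longrightarrow> \<sigma> ` ins \<alpha>2 \<inter> \<tau> ` outs \<alpha>2 = {} \<Longrightarrow>
      \<exists>\<beta> Z. reroutes S c \<sigma> \<tau> A \<alpha>2 \<beta> Z"
    and inj: "inj_on \<tau> (outs (Seq \<alpha>1 \<alpha>2))"
    and disj: "\<sigma> ` ins (Seq \<alpha>1 \<alpha>2) \<inter> \<tau> ` outs (Seq \<alpha>1 \<alpha>2) = {}"
  shows "\<exists>\<beta> Z. reroutes S c \<sigma> \<tau> A (Seq \<alpha>1 \<alpha>2) \<beta> Z"
proof -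
  define I where "I = ins (Seq \<alpha>1 \<alpha>2)"
  define O' where "O' = outs (Seq \<alpha>1 \<alpha>2)"
  define B where "B = A \<union> \<tau> ` O' \<union> \<sigma> ` I"
  have B: "\<sigma> ` I \<subseteq> B" "\<tau> ` O' \<subseteq> B" "finite B"
    using A finite_outs[of "Seq \<alpha>1 \<alpha>2"] finite_subset[OF ins_subset_vars finite_vars, of "Seq \<alpha>1 \<alpha>2"]
    by (auto simp: B_def I_def O'_def)
  obtain f where f: "inj_on f (outs \<alpha>1)" "f ` outs \<alpha>1 \<inter> B = {}"
    using ex_fresh_inj[OF infin B(3) finite_outs[of \<alpha>1]] by blast
  have im: "\<sigma> ` ins \<alpha>1 \<subseteq> \<sigma> ` I" "\<sigma> ` (ins \<alpha>2 - outs \<alpha>1) \<subseteq> \<sigma> ` I"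
    "\<tau> ` outs \<alpha>1 \<subseteq> \<tau> ` O'" "\<tau> ` outs \<alpha>2 \<subseteq> \<tau> ` O'"
    by (auto simp: I_def O'_def)
  define F where "F = f ` outs \<alpha>1"
  have F: "finite F" "F \<inter> B = {}"
    using f(2) by (auto simp: F_def finite_outs)
  have avoid_F: "P \<inter> F = {}" if "P \<subseteq> \<sigma> ` I \<or> P \<subseteq> \<tau> ` O'" for P
  proof -
    have "P \<subseteq> B" using that B(1,2) by (meson order_trans)
    then show ?thesis using F(2) by blast
  qed
  have disjoint: "P \<inter> Q = {}" if "P \<subseteq> \<sigma> ` I" "Q \<subseteq> \<tau> ` O'" for P Q
    using disj[folded I_def O'_def] that by blast
  have "\<sigma> ` ins \<alpha>1 \<inter> f ` outs \<alpha>1 = {}"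
    using avoid_F im(1) by (simp add: F_def)
  then obtain \<beta>1 Z1 where \<beta>1: "reroutes S c \<sigma> f B \<alpha>1 \<beta>1 Z1"
    using IH1[OF B(3) f(1)] by blast
  note \<beta>1' = \<beta>1[unfolded reroutes_def]
  \<comment> \<open>This is the override in the composition clause of \<open>run\<close>, moved from
    values to places: what \<open>\<alpha>1\<close> wrote is read from its fresh place, everything
    else from its \<sigma>-place.\<close>
  define \<sigma>2 where "\<sigma>2 = override_on \<sigma> f (outs \<alpha>1)"
  have \<sigma>2: "\<sigma>2 ` ins \<alpha>2 \<subseteq> \<sigma> ` (ins \<alpha>2 - outs \<alpha>1) \<union> f ` outs \<alpha>1" "\<sigma> ` (ins \<alpha>2 - outs \<alpha>1) \<subseteq> \<sigma>2 ` ins \<alpha>2"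
    by (auto simp: \<sigma>2_def override_on_def image_iff)
  \<comment> \<open>The auxiliary variables of the second operand must not overwrite anything that
    \<open>\<beta>1\<close> wrote.\<close>
  define C where "C = B \<union> f ` outs \<alpha>1 \<union> Z1"
  have "finite C"
    using B \<beta>1' finite_outs[of \<alpha>1] by (simp add: C_def)
  moreover have "inj_on \<tau> (outs \<alpha>2)"
    by (rule inj_on_subset[OF inj]) simp
  moreover have "\<sigma>2 ` ins \<alpha>2 \<inter> \<tau> ` outs \<alpha>2 = {}"
  proof -
    have "P \<inter> T = {}" if "P \<subseteq> Q \<union> F" "Q \<inter> T = {}" "T \<inter> F = {}" for P Q T
      using that by blast
    from this[OF \<sigma>2(1)[folded F_def] disjoint[OF im(2,4)] avoid_F[OF disjI2[OF im(4)]]]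
    show ?thesis .
  qed
  ultimately obtain \<beta>2 Z2 where \<beta>2: "reroutes S c \<sigma>2 \<tau> C \<alpha>2 \<beta>2 Z2"
    using IH2 by blast
  note \<beta>2' = \<beta>2[unfolded reroutes_def]
  have out: "outs \<beta>1 = f ` outs \<alpha>1 \<union> Z1" "outs \<beta>2 = \<tau> ` outs \<alpha>2 \<union> Z2"
    and fin: "finite Z1" "finite Z2"
    and "ins \<beta>1 = \<sigma> ` ins \<alpha>1" "ins \<beta>2 = \<sigma>2 ` ins \<alpha>2"
    and Z: "Z1 \<inter> (B \<union> f ` outs \<alpha>1) = {}" "Z2 \<inter> (B \<union> f ` outs \<alpha>1 \<union> Z1) = {}"
    using \<beta>1' \<beta>2' by (auto simp: C_def)
  have avoid_O: "P \<inter> (F \<union> Z1 \<union> Z2) = {}" if "P \<subseteq> \<sigma> ` I \<or> P \<subseteq> \<tau> ` O'" for P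
  proof -
    have "P \<subseteq> B" using that B(1,2) by (meson order_trans)
    then show ?thesis using F(2) Z by blast
  qed
  have out_disj: "outs \<beta>1 \<inter> outs \<beta>2 = {}"
    using avoid_O[OF disjI2[OF im(4)]] Z(2) unfolding out F_def by blast
  have ins_seq: "ins (Seq \<beta>1 \<beta>2) = \<sigma> ` I"
  proof -
    have "\<sigma> ` I = \<sigma> ` ins \<alpha>1 \<union> \<sigma> ` (ins \<alpha>2 - outs \<alpha>1)"
      by (auto simp: I_def)
    moreover have "\<sigma> ` I \<inter> outs \<beta>1 = {}"
      using avoid_O[of "\<sigma> ` I"] unfolding out F_def by blast
    ultimately show ?thesis
      using \<sigma>2 out(1) \<open>ins \<beta>1 = _\<close> \<open>ins \<beta>2 = _\<close> by auto
  qed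
  have "io_disjoint (Seq \<beta>1 \<beta>2)"
  proof -
    have "\<sigma> ` I \<inter> outs (Seq \<beta>1 \<beta>2) = {}"
      using avoid_O[of "\<sigma> ` I"] disjoint[OF order_refl im(4)] by (auto simp: out F_def)
    then show ?thesis
      using \<beta>1' \<beta>2' ins_seq by simp
  qed
  have run_seq: "run D (Seq \<beta>1 \<beta>2) \<nu> \<kappa> \<longleftrightarrow> (\<forall>z\<in>Z1 \<union> Z2. \<kappa> z = c) \<and> run D \<alpha>1 (\<nu> \<circ> \<sigma>) (\<kappa> \<circ> f) \<and>
      run D \<alpha>2 (override_on (\<nu> \<circ> \<sigma>) (\<kappa> \<circ> f) (outs \<alpha>1)) (\<kappa> \<circ> \<tau>)" for D \<nu> \<kappa>
  proof -
    \<comment> \<open>The outputs of \<open>\<beta>1\<close> and \<open>\<beta>2\<close> are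
      disjoint, so the final \<kappa> still records the intermediate valuation and the
      \<open>\<exists>\<close> of the composition disappears.\<close>
    have "run D \<beta>1 \<nu> \<kappa> \<and> run D \<beta>2 (override_on \<nu> \<kappa> (outs \<beta>1)) \<kappa>"
      if "run D \<beta>1 \<nu> \<kappa>'" "run D \<beta>2 (override_on \<nu> \<kappa>' (outs \<beta>1)) \<kappa>" "\<forall>v\<in>outs \<beta>1 - outs \<beta>2. \<kappa>' v = \<kappa> v"
      for \<kappa>'
    proof -
      have *: "\<forall>v\<in>outs \<beta>1. \<kappa>' v = \<kappa> v"
        using that(3) out_disj by blast
      then have "override_on \<nu> \<kappa>' (outs \<beta>1) = override_on \<nu> \<kappa> (outs \<beta>1)"
        by (auto simp: override_on_def)
      moreover have "run D \<beta>1 \<nu> \<kappa>' \<longleftrightarrow> run D \<beta>1 \<nu> \<kappa>"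
        using * by (intro run_cong) auto
      ultimately show ?thesis using that by simp
    qed
    then have "run D (Seq \<beta>1 \<beta>2) \<nu> \<kappa> \<longleftrightarrow> run D \<beta>1 \<nu> \<kappa> \<and> run D \<beta>2 (override_on \<nu> \<kappa> (outs \<beta>1)) \<kappa>"
      by auto
    moreover have "run D \<alpha>2 (override_on \<nu> \<kappa> (outs \<beta>1) \<circ> \<sigma>2) (\<kappa> \<circ> \<tau>) \<longleftrightarrow>
        run D \<alpha>2 (override_on (\<nu> \<circ> \<sigma>) (\<kappa> \<circ> f) (outs \<alpha>1)) (\<kappa> \<circ> \<tau>)"
    proof (intro run_cong)
      fix v assume "v \<in> ins \<alpha>2"
      moreover have "\<sigma> v \<notin> outs \<beta>1" if "v \<in> ins \<alpha>2 - outs \<alpha>1"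
      proof -
        have "\<sigma> v \<in> \<sigma> ` I" using that im(2) by blast
        then show ?thesis using avoid_O[of "\<sigma> ` I"] unfolding out F_def by blast
      qed
      ultimately show "(override_on \<nu> \<kappa> (outs \<beta>1) \<circ> \<sigma>2) v = override_on (\<nu> \<circ> \<sigma>) (\<kappa> \<circ> f) (outs \<alpha>1) v"
        using out(1) by (auto simp: override_on_def \<sigma>2_def)
    qed auto
    ultimately show ?thesis
      using \<beta>1' \<beta>2' by auto
  qed
  define X where "X = outs \<alpha>1 - outs \<alpha>2"
  have X: "X \<subseteq> outs \<alpha>1" "\<tau> ` X \<inter> \<tau> ` outs \<alpha>2 = {}" "\<tau> ` X \<subseteq> \<tau> ` O'"
    using inj by (auto simp: X_def O'_def inj_on_def)
  have fX: "f ` X \<subseteq> outs \<beta>1"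
    using X(1) out(1) by auto
  then have fX_seq: "f ` X \<subseteq> outs (Seq \<beta>1 \<beta>2)"
    by auto
  \<comment> \<open>The sources \<open>f x\<close> are outputs of \<open>\<beta>1\<close>, so these
    copies add no inputs.\<close>
  have "\<exists>\<gamma>. is_flif S \<gamma> \<and> io_disjoint \<gamma> \<and> outs \<gamma> = outs (Seq \<beta>1 \<beta>2) \<union> \<tau> ` X \<and>
    ins \<gamma> = ins (Seq \<beta>1 \<beta>2) \<union> (f ` X - outs (Seq \<beta>1 \<beta>2)) \<and>
    (\<forall>D \<nu> \<kappa>. run D \<gamma> \<nu> \<kappa> \<longleftrightarrow> run D (Seq \<beta>1 \<beta>2) \<nu> \<kappa> \<and>
      (\<forall>x\<in>X. \<kappa> (\<tau> x) = override_on \<nu> \<kappa> (outs (Seq \<beta>1 \<beta>2)) (f x)))"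
  proof (rule ex_copy)
    show "finite X" by (simp add: X_def finite_outs)
    show "inj_on \<tau> X" by (rule inj_on_subset[OF inj]) (auto simp: X_def)
    have "\<tau> ` X \<inter> outs (Seq \<beta>1 \<beta>2) = {}"
      using X(2) avoid_O[OF disjI2[OF X(3)]] by (auto simp: out F_def)
    then show "\<tau> ` X \<inter> (outs (Seq \<beta>1 \<beta>2) \<union> ins (Seq \<beta>1 \<beta>2) \<union> f ` X) = {}"
      unfolding ins_seq using disjoint[OF order_refl X(3)] fX_seq by blast
  qed (use \<open>io_disjoint (Seq \<beta>1 \<beta>2)\<close> \<beta>1' \<beta>2' in simp_all)
  then obtain \<gamma> where \<gamma>: "is_flif S \<gamma>" "io_disjoint \<gamma>" "outs \<gamma> = outs (Seq \<beta>1 \<beta>2) \<union> \<tau> ` X"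
    "ins \<gamma> = ins (Seq \<beta>1 \<beta>2) \<union> (f ` X - outs (Seq \<beta>1 \<beta>2))"
    "\<And>D \<nu> \<kappa>. run D \<gamma> \<nu> \<kappa> \<longleftrightarrow> run D (Seq \<beta>1 \<beta>2) \<nu> \<kappa> \<and>
      (\<forall>x\<in>X. \<kappa> (\<tau> x) = override_on \<nu> \<kappa> (outs (Seq \<beta>1 \<beta>2)) (f x))"
    by metis
  have ins_\<gamma>: "ins \<gamma> = \<sigma> ` I"
    using \<gamma>(4) ins_seq fX by auto
  have run_\<gamma>: "run D \<gamma> \<nu> \<kappa> \<longleftrightarrow> (\<forall>z\<in>Z1 \<union> Z2. \<kappa> z = c) \<and> run D \<alpha>1 (\<nu> \<circ> \<sigma>) (\<kappa> \<circ> f) \<and>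
      run D \<alpha>2 (override_on (\<nu> \<circ> \<sigma>) (\<kappa> \<circ> f) (outs \<alpha>1)) (\<kappa> \<circ> \<tau>) \<and> (\<forall>x\<in>X. \<kappa> (\<tau> x) = \<kappa> (f x))"
    for D \<nu> \<kappa>
    unfolding \<gamma>(5) run_seq using fX by (auto simp: override_on_def)
  have FZ: "F \<inter> (Z1 \<union> Z2) = {}"
    using Z by (auto simp: F_def)
  have "F \<inter> ins \<gamma> = {}"
    using avoid_F[of "\<sigma> ` I"] ins_\<gamma> by blast
  then obtain \<delta> where \<delta>: "is_flif S \<delta>" "io_disjoint \<delta>" "outs \<delta> = outs \<gamma> \<union> F" "ins \<delta> = ins \<gamma>"
    "\<forall>D \<nu> \<kappa>. run D \<delta> \<nu> \<kappa> \<longleftrightarrow>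
      (\<forall>z\<in>F. \<kappa> z = c) \<and> (\<exists>\<kappa>'. (\<forall>v. v \<notin> F \<longrightarrow> \<kappa>' v = \<kappa> v) \<and> run D \<gamma> \<nu> \<kappa>')"
    by (rule obtain_reset[OF F(1) _ \<gamma>(2,1)]) (rule that)
  note \<delta> = \<delta>(1-4) \<delta>(5)[rule_format]
  have "run D \<delta> \<nu> \<kappa> \<longleftrightarrow> (\<forall>z\<in>F \<union> Z1 \<union> Z2. \<kappa> z = c) \<and> run D (Seq \<alpha>1 \<alpha>2) (\<nu> \<circ> \<sigma>) (\<kappa> \<circ> \<tau>)" for D \<nu> \<kappa>
  proof -
    have \<tau>F: "\<tau> x \<notin> F" if "x \<in> O'" for x
      using that avoid_F[of "\<tau> ` O'"] by blast
    have cong2: "run D \<alpha>2 \<mu> (\<kappa>' \<circ> \<tau>) \<longleftrightarrow> run D \<alpha>2 \<mu> (\<kappa> \<circ> \<tau>)"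
      if "\<forall>v. v \<notin> F \<longrightarrow> \<kappa>' v = \<kappa> v" for \<kappa>' \<mu>
      using that \<tau>F by (intro run_cong) (auto simp: O'_def)
    have congZ: "(\<forall>z\<in>Z1 \<union> Z2. \<kappa>' z = c) \<longleftrightarrow> (\<forall>z\<in>Z1 \<union> Z2. \<kappa> z = c)"
      if "\<forall>v. v \<notin> F \<longrightarrow> \<kappa>' v = \<kappa> v" for \<kappa>'
      using that FZ by auto
    \<comment> \<open>Forgetting the contents of \<open>F\<close> is the choice of an intermediate
      valuation in \<open>run\<close> for the original composition.\<close>
    have "(\<exists>\<kappa>'. (\<forall>v. v \<notin> F \<longrightarrow> \<kappa>' v = \<kappa> v) \<and> run D \<gamma> \<nu> \<kappa>') \<longleftrightarrow>
        (\<forall>z\<in>Z1 \<union> Z2. \<kappa> z = c) \<and> run D (Seq \<alpha>1 \<alpha>2) (\<nu> \<circ> \<sigma>) (\<kappa> \<circ> \<tau>)" (is "?L \<longleftrightarrow> ?R")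
    proof
      assume ?L
      then obtain \<kappa>' where \<kappa>': "\<forall>v. v \<notin> F \<longrightarrow> \<kappa>' v = \<kappa> v" "run D \<gamma> \<nu> \<kappa>'"
        by blast
      have "run D \<alpha>2 (override_on (\<nu> \<circ> \<sigma>) (\<kappa>' \<circ> f) (outs \<alpha>1)) (\<kappa> \<circ> \<tau>)"
        using \<kappa>'(2) unfolding run_\<gamma> cong2[OF \<kappa>'(1)] by blast
      moreover have "\<forall>x\<in>X. (\<kappa>' \<circ> f) x = (\<kappa> \<circ> \<tau>) x"
        using \<kappa>' \<tau>F by (simp add: run_\<gamma> X_def O'_def)
      moreover have "\<forall>z\<in>Z1 \<union> Z2. \<kappa> z = c" "run D \<alpha>1 (\<nu> \<circ> \<sigma>) (\<kappa>' \<circ> f)"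
        using \<kappa>'(2) unfolding run_\<gamma> congZ[OF \<kappa>'(1)] by blast+
      ultimately show ?R
        unfolding X_def by (simp del: comp_apply) blast
    next
      assume R: ?R
      then obtain \<mu> where \<mu>: "run D \<alpha>1 (\<nu> \<circ> \<sigma>) \<mu>"
        "run D \<alpha>2 (override_on (\<nu> \<circ> \<sigma>) \<mu> (outs \<alpha>1)) (\<kappa> \<circ> \<tau>)" "\<forall>v\<in>X. \<mu> v = (\<kappa> \<circ> \<tau>) v"
        by (auto simp: X_def)
      \<comment> \<open>The contents of \<open>F\<close> before the reset: the intermediate
        valuation \<mu>, carried to the fresh places along \<open>f\<close>.\<close>
      define \<kappa>' where "\<kappa>' = override_on \<kappa> (\<mu> \<circ> inv_into (outs \<alpha>1) f) F"
      have \<kappa>'_f: "\<kappa>' (f x) = \<mu> x" if "x \<in> outs \<alpha>1" for x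
        using that f(1) by (simp add: \<kappa>'_def F_def)
      have \<kappa>'_notF: "\<forall>v. v \<notin> F \<longrightarrow> \<kappa>' v = \<kappa> v"
        by (simp add: \<kappa>'_def)
      have "run D \<alpha>1 (\<nu> \<circ> \<sigma>) (\<kappa>' \<circ> f)"
        using \<mu>(1) run_cong[of \<alpha>1 "\<nu> \<circ> \<sigma>" "\<nu> \<circ> \<sigma>" \<mu> "\<kappa>' \<circ> f" D] \<kappa>'_f by simp
      moreover have "override_on (\<nu> \<circ> \<sigma>) (\<kappa>' \<circ> f) (outs \<alpha>1) = override_on (\<nu> \<circ> \<sigma>) \<mu> (outs \<alpha>1)"
        using \<kappa>'_f by (auto simp: override_on_def)
      moreover have "\<forall>x\<in>X. \<kappa>' (\<tau> x) = \<kappa>' (f x)"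
        using \<mu>(3) \<kappa>'_f \<kappa>'_notF \<tau>F by (simp add: X_def O'_def)
      ultimately have "run D \<gamma> \<nu> \<kappa>'"
        using R \<mu>(2) congZ[OF \<kappa>'_notF] cong2[OF \<kappa>'_notF] by (simp add: run_\<gamma>)
      then show ?L using \<kappa>'_notF by blast
    qed
    then show ?thesis
      unfolding \<delta>(5) by blast
  qed
  moreover have "outs \<delta> = \<tau> ` O' \<union> (F \<union> Z1 \<union> Z2)"
    using \<delta>(3) \<gamma>(3) out by (auto simp: O'_def F_def X_def)
  moreover have "(F \<union> Z1 \<union> Z2) \<inter> (A \<union> \<tau> ` O') = {}"
    using F(2) Z by (auto simp: B_def)
  ultimately have "reroutes S c \<sigma> \<tau> A (Seq \<alpha>1 \<alpha>2) \<delta> (F \<union> Z1 \<union> Z2)"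
    unfolding reroutes_def I_def[symmetric] O'_def[symmetric]
    using \<delta>(1,2,4) ins_\<gamma> F(1) fin by blast
  then show ?thesis by blast
qed

text \<open>All outputs of both operands are outputs of the union, so \<tau> already places them
  injectively and nothing has to be projected away.\<close>

lemma ex_reroutes_Cup:
  fixes \<alpha>1 \<alpha>2 :: "('r, 'v, 'd) flif"
  assumes A: "finite A"
    and IH1: "\<And>\<sigma> \<tau> A. finite A \<Longrightarrow> inj_on \<tau> (outs \<alpha>1) \<Longrightarrow> \<sigma> ` ins \<alpha>1 \<inter> \<tau> ` outs \<alpha>1 = {} \<Longrightarrow>
      \<exists>\<beta> Z. reroutes S c \<sigma> \<tau> A \<alpha>1 \<beta> Z"
    and IH2: "\<And>\<sigma> \<tau> A. finite A \<Longrightarrow> inj_on \<tau> (outs \<alpha>2) \<Longrightarrow> \<sigma> ` ins \<alpha>2 \<inter> \<tau> ` outs \<alpha>2 = {} \<Longrightarrow>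
      \<exists>\<beta> Z. reroutes S c \<sigma> \<tau> A \<alpha>2 \<beta> Z"
    and inj: "inj_on \<tau> (outs (Cup \<alpha>1 \<alpha>2))"
    and disj: "\<sigma> ` ins (Cup \<alpha>1 \<alpha>2) \<inter> \<tau> ` outs (Cup \<alpha>1 \<alpha>2) = {}"
  shows "\<exists>\<beta> Z. reroutes S c \<sigma> \<tau> A (Cup \<alpha>1 \<alpha>2) \<beta> Z"
proof -
  have inj12: "inj_on \<tau> (outs \<alpha>1)" "inj_on \<tau> (outs \<alpha>2)"
    by (rule inj_on_subset[OF inj], simp)+
  have disj12: "\<sigma> ` ins \<alpha>1 \<inter> \<tau> ` outs \<alpha>1 = {}" "\<sigma> ` ins \<alpha>2 \<inter> \<tau> ` outs \<alpha>2 = {}"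
    using disj by auto
  have ex12: "\<forall>A. finite A \<longrightarrow> (\<exists>\<beta> Z. reroutes S c \<sigma> \<tau> A \<alpha>1 \<beta> Z)"
    "\<forall>A. finite A \<longrightarrow> (\<exists>\<beta> Z. reroutes S c \<sigma> \<tau> A \<alpha>2 \<beta> Z)"
    using IH1[OF _ inj12(1) disj12(1)] IH2[OF _ inj12(2) disj12(2)] by simp_all
  note pair = ex_reroutes_pair[OF ex12 A
      inj[unfolded outs.simps] disj[unfolded outs.simps ins.simps],
      folded outs.simps(7) ins.simps(7)]
  obtain \<gamma>1 \<gamma>2 Z where \<gamma>: "is_flif S \<gamma>1" "is_flif S \<gamma>2" "io_disjoint \<gamma>1" "io_disjoint \<gamma>2"
    "finite Z" "Z \<inter> (A \<union> \<tau> ` outs (Cup \<alpha>1 \<alpha>2) \<union> \<sigma> ` ins (Cup \<alpha>1 \<alpha>2)) = {}"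
    "outs \<gamma>1 = \<tau> ` outs (Cup \<alpha>1 \<alpha>2) \<union> Z" "outs \<gamma>2 = \<tau> ` outs (Cup \<alpha>1 \<alpha>2) \<union> Z"
    "ins \<gamma>1 \<union> ins \<gamma>2 = \<sigma> ` ins (Cup \<alpha>1 \<alpha>2)"
    and run_\<gamma>: "\<forall>D \<nu> \<kappa>. run D \<gamma>1 \<nu> \<kappa> \<longleftrightarrow> (\<forall>z\<in>Z. \<kappa> z = c) \<and> run D \<alpha>1 (\<nu> \<circ> \<sigma>) (\<kappa> \<circ> \<tau>) \<and>
      (\<forall>x\<in>outs \<alpha>2 - outs \<alpha>1. (\<kappa> \<circ> \<tau>) x = (\<nu> \<circ> \<sigma>) x)"
    "\<forall>D \<nu> \<kappa>. run D \<gamma>2 \<nu> \<kappa> \<longleftrightarrow> (\<forall>z\<in>Z. \<kappa> z = c) \<and> run D \<alpha>2 (\<nu> \<circ> \<sigma>) (\<kappa> \<circ> \<tau>) \<and>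
      (\<forall>x\<in>outs \<alpha>1 - outs \<alpha>2. (\<kappa> \<circ> \<tau>) x = (\<nu> \<circ> \<sigma>) x)"
    by (rule pair) (rule that)
  note run_\<gamma> = run_\<gamma>[rule_format]
  have outs_eq: "outs \<gamma>2 = outs \<gamma>1"
    using \<gamma> by simp
  then have io: "ins (Cup \<gamma>1 \<gamma>2) = \<sigma> ` ins (Cup \<alpha>1 \<alpha>2)"
    "outs (Cup \<gamma>1 \<gamma>2) = \<tau> ` outs (Cup \<alpha>1 \<alpha>2) \<union> Z"
    using \<gamma>(9,7) by (simp_all del: ins.simps(7) add: ins.simps(7)[of \<gamma>1 \<gamma>2])
  have "ins (Cup \<gamma>1 \<gamma>2) \<inter> outs (Cup \<gamma>1 \<gamma>2) = {}"
    using \<gamma>(6) disj unfolding io by blast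
  then have "io_disjoint (Cup \<gamma>1 \<gamma>2)"
    using \<gamma>(3,4) by simp
  moreover have "run D (Cup \<gamma>1 \<gamma>2) \<nu> \<kappa> \<longleftrightarrow>
      (\<forall>z\<in>Z. \<kappa> z = c) \<and> run D (Cup \<alpha>1 \<alpha>2) (\<nu> \<circ> \<sigma>) (\<kappa> \<circ> \<tau>)" for D \<nu> \<kappa>
    by (simp add: outs_eq run_\<gamma>) blast
  ultimately have "reroutes S c \<sigma> \<tau> A (Cup \<alpha>1 \<alpha>2) (Cup \<gamma>1 \<gamma>2) Z"
    unfolding reroutes_def io using \<gamma>(1,2,5,6) by (simp del: run.simps) blast
  then show ?thesis by blast
qed

text \<open>The outputs \<open>X\<close> of \<open>\<alpha>2\<close> alone are not outputs of the
  difference, so nothing is known of \<tau> on them. They get fresh places \<open>P\<close>, reset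
  at the end. Projecting over \<open>P\<close> is harmless even after a difference, because
  \<open>\<gamma>1\<close> forces every place in \<open>P\<close> to hold an input value: only one
  candidate for the contents of \<open>P\<close> remains.\<close>

lemma ex_reroutes_Minus:
  fixes \<alpha>1 \<alpha>2 :: "('r, 'v, 'd) flif"
  assumes infin: "infinite (UNIV :: 'v set)" and A: "finite A"
    and IH1: "\<And>\<sigma> \<tau> A. finite A \<Longrightarrow> inj_on \<tau> (outs \<alpha>1) \<Longrightarrow> \<sigma> ` ins \<alpha>1 \<inter> \<tau> ` outs \<alpha>1 = {} \<Longrightarrow>
      \<exists>\<beta> Z. reroutes S c \<sigma> \<tau> A \<alpha>1 \<beta> Z"
    and IH2: "\<And>\<sigma> \<tau> A. finite A \<Longrightarrow> inj_on \<tau> (outs \<alpha>2) \<Longrightarrow> \<sigma> ` ins \<alpha>2 \<inter> \<tau> ` outs \<alpha>2 = {} \<Longrightarrow>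
      \<exists>\<beta> Z. reroutes S c \<sigma> \<tau> A \<alpha>2 \<beta> Z"
    and inj: "inj_on \<tau> (outs (Minus \<alpha>1 \<alpha>2))"
    and disj: "\<sigma> ` ins (Minus \<alpha>1 \<alpha>2) \<inter> \<tau> ` outs (Minus \<alpha>1 \<alpha>2) = {}"
  shows "\<exists>\<beta> Z. reroutes S c \<sigma> \<tau> A (Minus \<alpha>1 \<alpha>2) \<beta> Z"
proof -
  define I where "I = ins (Minus \<alpha>1 \<alpha>2)"
  define X where "X = outs \<alpha>2 - outs \<alpha>1"
  define B where "B = A \<union> \<tau> ` outs \<alpha>1 \<union> \<sigma> ` I"
  have "finite I"
    unfolding I_def using finite_subset[OF ins_subset_vars finite_vars] .
  then have "finite B"
    using A by (simp add: B_def finite_outs)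
  moreover have "finite X"
    by (simp add: X_def finite_outs)
  ultimately obtain f where f: "inj_on f X" "f ` X \<inter> B = {}"
    using ex_fresh_inj[OF infin] by metis
  define P where "P = f ` X"
  have P: "finite P" "P \<inter> B = {}"
    using f \<open>finite X\<close> by (auto simp: P_def)
  define \<tau>' where "\<tau>' = override_on \<tau> f X"
  have \<tau>'_X: "\<tau>' x = f x" if "x \<in> X" for x
    using that by (simp add: \<tau>'_def)
  have \<tau>'_outs: "\<tau>' x = \<tau> x" if "x \<in> outs \<alpha>1" for x
    using that by (simp add: \<tau>'_def X_def)
  define O' where "O' = outs \<alpha>1 \<union> outs \<alpha>2"
  have O': "O' = outs \<alpha>1 \<union> X" "outs \<alpha>1 \<inter> X = {}"
    by (auto simp: O'_def X_def)
  have im: "\<tau>' ` outs \<alpha>1 = \<tau> ` outs \<alpha>1" "\<tau>' ` X = P"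
    using \<tau>'_X \<tau>'_outs by (auto simp: P_def)
  have im_O': "\<tau>' ` O' = \<tau> ` outs \<alpha>1 \<union> P"
    using im by (simp add: O' image_Un)
  have inj': "inj_on \<tau>' O'"
  proof -
    have "inj_on \<tau>' (outs \<alpha>1)" "inj_on \<tau>' X"
      using inj f(1) inj_on_cong[of "outs \<alpha>1" \<tau>' \<tau>] inj_on_cong[of X \<tau>' f] \<tau>'_X \<tau>'_outs by auto
    moreover have "\<tau> ` outs \<alpha>1 \<inter> P = {}"
      using P(2) by (auto simp: B_def)
    ultimately show ?thesis
      unfolding O'(1) inj_on_Un using im O'(2)
      by (metis Diff_triv Int_commute)
  qed
  have disj': "\<sigma> ` I \<inter> \<tau>' ` O' = {}"
    using disj P(2) by (auto simp: im_O' B_def I_def[symmetric] simp del: ins.simps)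
  have inj12: "inj_on \<tau>' (outs \<alpha>1)" "inj_on \<tau>' (outs \<alpha>2)"
    by (rule inj_on_subset[OF inj'], simp add: O'_def)+
  have disj12: "\<sigma> ` ins \<alpha>1 \<inter> \<tau>' ` outs \<alpha>1 = {}" "\<sigma> ` ins \<alpha>2 \<inter> \<tau>' ` outs \<alpha>2 = {}"
    using disj' by (auto simp: I_def O'_def)
  have ex12: "\<forall>A. finite A \<longrightarrow> (\<exists>\<beta> Z. reroutes S c \<sigma> \<tau>' A \<alpha>1 \<beta> Z)"
    "\<forall>A. finite A \<longrightarrow> (\<exists>\<beta> Z. reroutes S c \<sigma> \<tau>' A \<alpha>2 \<beta> Z)"
    using IH1[OF _ inj12(1) disj12(1)] IH2[OF _ inj12(2) disj12(2)] by simp_all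
  note pair = ex_reroutes_pair[OF ex12 A
      inj'[unfolded O'_def] disj'[unfolded O'_def I_def ins.simps],
      folded O'_def ins.simps(8), folded I_def X_def]
  obtain \<gamma>1 \<gamma>2 Z where \<gamma>: "is_flif S \<gamma>1" "is_flif S \<gamma>2" "io_disjoint \<gamma>1" "io_disjoint \<gamma>2"
    "finite Z" "Z \<inter> (A \<union> \<tau>' ` O' \<union> \<sigma> ` I) = {}"
    "outs \<gamma>1 = \<tau>' ` O' \<union> Z" "outs \<gamma>2 = \<tau>' ` O' \<union> Z" "ins \<gamma>1 \<union> ins \<gamma>2 = \<sigma> ` I"
    and run_\<gamma>: "\<forall>D \<nu> \<kappa>. run D \<gamma>1 \<nu> \<kappa> \<longleftrightarrow> (\<forall>z\<in>Z. \<kappa> z = c) \<and> run D \<alpha>1 (\<nu> \<circ> \<sigma>) (\<kappa> \<circ> \<tau>') \<and>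
      (\<forall>x\<in>X. (\<kappa> \<circ> \<tau>') x = (\<nu> \<circ> \<sigma>) x)"
    "\<forall>D \<nu> \<kappa>. run D \<gamma>2 \<nu> \<kappa> \<longleftrightarrow> (\<forall>z\<in>Z. \<kappa> z = c) \<and> run D \<alpha>2 (\<nu> \<circ> \<sigma>) (\<kappa> \<circ> \<tau>') \<and>
      (\<forall>x\<in>outs \<alpha>1 - outs \<alpha>2. (\<kappa> \<circ> \<tau>') x = (\<nu> \<circ> \<sigma>) x)"
    by (rule pair) (rule that)
  note run_\<gamma> = run_\<gamma>[rule_format]
  have outs_eq: "outs \<gamma>2 = outs \<gamma>1"
    using \<gamma> by simp
  then have io: "ins (Minus \<gamma>1 \<gamma>2) = \<sigma> ` I" "outs (Minus \<gamma>1 \<gamma>2) = \<tau>' ` O' \<union> Z"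
    using \<gamma>(7,9) by simp_all
  have "ins (Minus \<gamma>1 \<gamma>2) \<inter> outs (Minus \<gamma>1 \<gamma>2) = {}"
    using \<gamma>(6) disj' unfolding io by blast
  then have "io_disjoint (Minus \<gamma>1 \<gamma>2)"
    using \<gamma>(3,4) by simp
  have run_minus: "run D (Minus \<gamma>1 \<gamma>2) \<nu> \<kappa> \<longleftrightarrow> run D \<gamma>1 \<nu> \<kappa> \<and> \<not> run D \<gamma>2 \<nu> \<kappa>" for D \<nu> \<kappa>
  proof -
    have "run D \<gamma>2 \<nu> (override_on \<nu> \<kappa> (outs \<gamma>1)) \<longleftrightarrow> run D \<gamma>2 \<nu> \<kappa>"
      by (intro run_cong) (auto simp: outs_eq)
    then show ?thesis by (simp add: outs_eq)
  qed
  have minus: "P \<inter> ins (Minus \<gamma>1 \<gamma>2) = {}" "is_flif S (Minus \<gamma>1 \<gamma>2)"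
    using P(2) \<gamma>(1,2) unfolding io by (auto simp: B_def)
  obtain \<delta> where \<delta>: "is_flif S \<delta>" "io_disjoint \<delta>" "outs \<delta> = outs (Minus \<gamma>1 \<gamma>2) \<union> P"
    "ins \<delta> = ins (Minus \<gamma>1 \<gamma>2)"
    "\<forall>D \<nu> \<kappa>. run D \<delta> \<nu> \<kappa> \<longleftrightarrow> (\<forall>z\<in>P. \<kappa> z = c) \<and>
      (\<exists>\<kappa>'. (\<forall>v. v \<notin> P \<longrightarrow> \<kappa>' v = \<kappa> v) \<and> run D (Minus \<gamma>1 \<gamma>2) \<nu> \<kappa>')"
    by (rule obtain_reset[OF P(1) minus(1) \<open>io_disjoint (Minus \<gamma>1 \<gamma>2)\<close> minus(2)]) (rule that)
  note \<delta> = \<delta>(1-4)[unfolded io] \<delta>(5)[rule_format]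
  have "run D \<delta> \<nu> \<kappa> \<longleftrightarrow> (\<forall>z\<in>Z \<union> P. \<kappa> z = c) \<and> run D (Minus \<alpha>1 \<alpha>2) (\<nu> \<circ> \<sigma>) (\<kappa> \<circ> \<tau>)" for D \<nu> \<kappa>
  proof -
    have notP: "\<tau> x \<notin> P" if "x \<in> outs \<alpha>1" for x
      using that P(2) by (auto simp: B_def)
    have key: "run D \<gamma>1 \<nu> \<kappa>' \<and> \<not> run D \<gamma>2 \<nu> \<kappa>' \<longleftrightarrow>
        (\<forall>z\<in>Z. \<kappa> z = c) \<and> run D (Minus \<alpha>1 \<alpha>2) (\<nu> \<circ> \<sigma>) (\<kappa> \<circ> \<tau>)"
      if \<kappa>': "\<forall>v. v \<notin> P \<longrightarrow> \<kappa>' v = \<kappa> v" "\<forall>x\<in>X. (\<kappa>' \<circ> \<tau>') x = (\<nu> \<circ> \<sigma>) x" for \<kappa>'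
    proof -
      have on_outs: "(\<kappa>' \<circ> \<tau>') x = (\<kappa> \<circ> \<tau>) x" if "x \<in> outs \<alpha>1" for x
        using that \<kappa>'(1) notP \<tau>'_outs by simp
      have "run D \<alpha>1 (\<nu> \<circ> \<sigma>) (\<kappa>' \<circ> \<tau>') \<longleftrightarrow> run D \<alpha>1 (\<nu> \<circ> \<sigma>) (\<kappa> \<circ> \<tau>)"
        using on_outs by (intro run_cong) auto
      \<comment> \<open>With input values in \<open>P\<close>, the second operand sees \<kappa> on
        \<open>outs \<alpha>1\<close> and the input elsewhere, as in the difference clause of
        \<open>run\<close>.\<close>
      moreover have "run D \<alpha>2 (\<nu> \<circ> \<sigma>) (\<kappa>' \<circ> \<tau>') \<longleftrightarrow>
          run D \<alpha>2 (\<nu> \<circ> \<sigma>) (override_on (\<nu> \<circ> \<sigma>) (\<kappa> \<circ> \<tau>) (outs \<alpha>1))"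
        using on_outs \<kappa>'(2) by (intro run_cong) (auto simp: override_on_def X_def)
      moreover have "(\<forall>z\<in>Z. \<kappa>' z = c) \<longleftrightarrow> (\<forall>z\<in>Z. \<kappa> z = c)"
        using \<kappa>'(1) \<gamma>(6) by (auto simp: im_O')
      ultimately show ?thesis
        using \<kappa>'(2) on_outs unfolding run_\<gamma> by auto
    qed
    \<comment> \<open>The one candidate: the place of each \<open>x\<close> in \<open>X\<close> is
      filled with the input value of \<open>x\<close>.\<close>
    define \<kappa>0 where "\<kappa>0 = override_on \<kappa> (\<nu> \<circ> \<sigma> \<circ> inv_into X f) P"
    have \<kappa>0: "\<forall>v. v \<notin> P \<longrightarrow> \<kappa>0 v = \<kappa> v" "\<forall>x\<in>X. (\<kappa>0 \<circ> \<tau>') x = (\<nu> \<circ> \<sigma>) x"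
      using f(1) by (auto simp: \<kappa>0_def \<tau>'_X P_def)
    have "(\<exists>\<kappa>'. (\<forall>v. v \<notin> P \<longrightarrow> \<kappa>' v = \<kappa> v) \<and> run D \<gamma>1 \<nu> \<kappa>' \<and> \<not> run D \<gamma>2 \<nu> \<kappa>') \<longleftrightarrow>
        (\<forall>z\<in>Z. \<kappa> z = c) \<and> run D (Minus \<alpha>1 \<alpha>2) (\<nu> \<circ> \<sigma>) (\<kappa> \<circ> \<tau>)" (is "?L \<longleftrightarrow> ?R")
    proof
      assume ?L
      then obtain \<kappa>' where \<kappa>': "\<forall>v. v \<notin> P \<longrightarrow> \<kappa>' v = \<kappa> v" "run D \<gamma>1 \<nu> \<kappa>' \<and> \<not> run D \<gamma>2 \<nu> \<kappa>'"
        by blast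
      then have "\<forall>x\<in>X. (\<kappa>' \<circ> \<tau>') x = (\<nu> \<circ> \<sigma>) x"
        unfolding run_\<gamma>(1) by blast
      from key[OF \<kappa>'(1) this] \<kappa>'(2) show ?R by (rule iffD1)
    next
      assume ?R
      then have "run D \<gamma>1 \<nu> \<kappa>0 \<and> \<not> run D \<gamma>2 \<nu> \<kappa>0"
        by (rule iffD2[OF key[OF \<kappa>0]])
      with \<kappa>0(1) show ?L by blast
    qed
    then show ?thesis
      unfolding \<delta>(5) run_minus by blast
  qed
  moreover have "outs \<delta> = \<tau> ` outs \<alpha>1 \<union> (Z \<union> P)"
    unfolding \<delta>(3) im_O' by blast
  moreover have "(Z \<union> P) \<inter> (A \<union> \<tau> ` outs \<alpha>1) = {}"
    using \<gamma>(6) P(2) by (auto simp: im_O' B_def)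
  ultimately have "reroutes S c \<sigma> \<tau> A (Minus \<alpha>1 \<alpha>2) \<delta> (Z \<union> P)"
    unfolding reroutes_def I_def[symmetric] outs.simps
    using \<delta>(1,2,4) \<gamma>(5) P(1) by blast
  then show ?thesis by blast
qed

section \<open>The induction and the theorem\<close>

text \<open>Atoms are renamed literally, without auxiliary variables: evaluating a renamed atom is
  evaluating the original under \<open>\<nu> \<circ> \<sigma>\<close> and
  \<open>\<kappa> \<circ> \<tau>\<close>. The disjointness hypothesis is io-disjointness of the
  renamed atom; thus \<open>x := x\<close> becomes \<open>\<tau> x := \<sigma> x\<close>.\<close>

lemma ex_reroutes:
  fixes \<alpha> :: "('r, 'v, 'd) flif"
  assumes "infinite (UNIV :: 'v set)" "is_flif S \<alpha>" "finite A" "inj_on \<tau> (outs \<alpha>)"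
    "\<sigma> ` ins \<alpha> \<inter> \<tau> ` outs \<alpha> = {}"
  shows "\<exists>\<beta> Z. reroutes S c \<sigma> \<tau> A \<alpha> \<beta> Z"
  using assms(2-)
proof (induction \<alpha> arbitrary: \<sigma> \<tau> A)
  case (Rel R xs ys)
  then have "reroutes S c \<sigma> \<tau> A (Rel R xs ys) (Rel R (map \<sigma> xs) (map \<tau> ys)) {}"
    by (auto simp: reroutes_def)
  then show ?case by blast
next
  case (EqVar x y)
  then have "reroutes S c \<sigma> \<tau> A (EqVar x y) (EqVar (\<sigma> x) (\<sigma> y)) {}"
    by (auto simp: reroutes_def)
  then show ?case by blast
next
  case (EqConst x d)
  then have "reroutes S c \<sigma> \<tau> A (EqConst x d) (EqConst (\<sigma> x) d) {}"
    by (auto simp: reroutes_def)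
  then show ?case by blast
next
  case (AsgVar x y)
  then have "reroutes S c \<sigma> \<tau> A (AsgVar x y) (AsgVar (\<tau> x) (\<sigma> y)) {}"
    by (auto simp: reroutes_def)
  then show ?case by blast
next
  case (AsgConst x d)
  then have "reroutes S c \<sigma> \<tau> A (AsgConst x d) (AsgConst (\<tau> x) d) {}"
    by (auto simp: reroutes_def)
  then show ?case by blast
next
  case (Seq \<alpha>1 \<alpha>2)
  then show ?case
    by (intro ex_reroutes_Seq[OF assms(1)]) simp_all
next
  case (Cup \<alpha>1 \<alpha>2)
  then show ?case
    by (intro ex_reroutes_Cup) simp_all
next
  case (Minus \<alpha>1 \<alpha>2)
  then show ?case
    by (intro ex_reroutes_Minus[OF assms(1)]) simp_all
qed

theorem theorem5p1:
  fixes S :: "'r schema" and \<alpha> :: "('r, 'v, 'd) flif" and \<rho> :: "'v \<Rightarrow> 'v" and W :: "'v set"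
  assumes "countable (UNIV :: 'd set)" and "infinite (UNIV :: 'd set)"
    and "infinite (UNIV :: 'v set)"
    and "is_schema S"
    and "is_flif S \<alpha>"
    and "bij_betw \<rho> (outs \<alpha>) W" and "W \<inter> vars \<alpha> = {}"
  shows "\<exists>\<beta> :: ('r, 'v, 'd) flif. is_flif S \<beta> \<and> io_disjoint \<beta> \<and>
    ins \<beta> = ins \<alpha> \<and>
    outs \<beta> \<supseteq> \<rho> ` outs \<alpha> \<and>
    (\<forall>V D \<nu>1. vars \<alpha> \<subseteq> V \<and> vars \<beta> \<subseteq> V \<and> is_instance S D \<and> \<nu>1 \<in> valuations V \<longrightarrow>
      {restrict \<nu>2 (outs \<alpha>) | \<nu>2. (\<nu>1, \<nu>2) \<in> sem V D \<alpha>} =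
      {restrict (\<nu>2 \<circ> \<rho>) (outs \<alpha>) | \<nu>2. (\<nu>1, \<nu>2) \<in> sem V D \<beta>})"
proof -
  have inj: "inj_on \<rho> (outs \<alpha>)" and img: "\<rho> ` outs \<alpha> = W"
    using assms(6) by (auto simp: bij_betw_def)
  \<comment> \<open>Any constant would serve; \<open>undefined\<close> names one.\<close>
  define c :: 'd where "c = undefined"
  \<comment> \<open>\<beta> must read the inputs of \<alpha> themselves, hence the identity for
    \<sigma>.\<close>
  have "id ` ins \<alpha> \<inter> \<rho> ` outs \<alpha> = {}"
    using ins_subset_vars[of \<alpha>] assms(7) img by auto
  from ex_reroutes[OF assms(3,5) finite.emptyI inj this]
  obtain \<beta> Z where "reroutes S c id \<rho> {} \<alpha> \<beta> Z"
    by blast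
  then have \<beta>: "is_flif S \<beta>" "io_disjoint \<beta>" "Z \<inter> \<rho> ` outs \<alpha> = {}" "outs \<beta> = \<rho> ` outs \<alpha> \<union> Z"
    "ins \<beta> = ins \<alpha>" "\<And>D \<nu> \<kappa>. run D \<beta> \<nu> \<kappa> \<longleftrightarrow> (\<forall>z\<in>Z. \<kappa> z = c) \<and> run D \<alpha> \<nu> (\<kappa> \<circ> \<rho>)"
    by (simp_all add: reroutes_def)
  have "{restrict \<nu>2 (outs \<alpha>) | \<nu>2. (\<nu>1, \<nu>2) \<in> sem V D \<alpha>} =
      {restrict (\<nu>2 \<circ> \<rho>) (outs \<alpha>) | \<nu>2. (\<nu>1, \<nu>2) \<in> sem V D \<beta>}" (is "?L = ?R")
    if V: "vars \<alpha> \<subseteq> V" "vars \<beta> \<subseteq> V" and \<nu>1: "\<nu>1 \<in> valuations V" for V D \<nu>1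
  proof (intro subset_antisym subsetI)
    fix g assume "g \<in> ?L"
    then obtain \<nu>2 where \<nu>2: "g = restrict \<nu>2 (outs \<alpha>)" "run D \<alpha> \<nu>1 \<nu>2"
      by (auto simp: sem_iff_run[OF V(1)])
    \<comment> \<open>The proper outputs are moved along \<rho> and \<open>Z\<close> gets its reset
      value; all other variables keep their value in \<open>\<nu>1\<close>, as inertia of \<beta>
      demands.\<close>
    define \<kappa> where "\<kappa> v = (if v \<in> Z then c else
      if v \<in> \<rho> ` outs \<alpha> then \<nu>2 (inv_into (outs \<alpha>) \<rho> v) else \<nu>1 v)" for v
    have \<kappa>: "(\<kappa> \<circ> \<rho>) x = \<nu>2 x" if "x \<in> outs \<alpha>" for x
      using that \<beta>(3) inj by (auto simp: \<kappa>_def)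
    have "run D \<alpha> \<nu>1 (\<kappa> \<circ> \<rho>)"
      using \<nu>2(2) \<kappa> run_cong[of \<alpha> \<nu>1 \<nu>1 \<nu>2 "\<kappa> \<circ> \<rho>" D] by simp
    then have "(\<nu>1, \<kappa>) \<in> sem V D \<beta>"
      using \<nu>1 unfolding sem_iff_run[OF V(2)] \<beta>(4,6) by (auto simp: \<kappa>_def)
    moreover have "g = restrict (\<kappa> \<circ> \<rho>) (outs \<alpha>)"
      using \<kappa> \<nu>2(1) by (auto simp: restrict_def)
    ultimately show "g \<in> ?R" by blast
  next
    fix g assume "g \<in> ?R"
    then obtain \<nu>2 where \<nu>2: "g = restrict (\<nu>2 \<circ> \<rho>) (outs \<alpha>)" "run D \<alpha> \<nu>1 (\<nu>2 \<circ> \<rho>)"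
      by (auto simp: sem_iff_run[OF V(2)] \<beta>(6))
    \<comment> \<open>Off its outputs, a result of \<alpha> must equal \<open>\<nu>1\<close>, also
      where \<beta> left proper or auxiliary values.\<close>
    define \<kappa> where "\<kappa> = override_on \<nu>1 (\<nu>2 \<circ> \<rho>) (outs \<alpha>)"
    have "run D \<alpha> \<nu>1 \<kappa>"
      using \<nu>2(2) run_cong[of \<alpha> \<nu>1 \<nu>1 "\<nu>2 \<circ> \<rho>" \<kappa> D] by (simp add: \<kappa>_def)
    then have "(\<nu>1, \<kappa>) \<in> sem V D \<alpha>"
      using \<nu>1 unfolding sem_iff_run[OF V(1)] by (auto simp: \<kappa>_def)
    moreover have "g = restrict \<kappa> (outs \<alpha>)"
      using \<nu>2(1) by (auto simp: restrict_def \<kappa>_def)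
    ultimately show "g \<in> ?L" by blast
  qed
  then show ?thesis
    using \<beta>(1,2,4,5) by (intro exI[of _ \<beta>]) simp
qed

end
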